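(* There exists a universal constant $C_0>0$ such that the following holds in the Bradley-Terry-Luce model described in the context, for any fixed $0<\delta<0.5$. Let $\{B_{k,\ell},Q_{k,\ell}\}$ be (deterministic) numbers, indexed by unordered pairs of distinct nodes, that are valid upper bounds in the sense that for all $1\le k,\ell\le n$, $k\ne \ell$, $$B_{k,\ell}\ge C_0\sqrt{\Omega_{k,\ell}(L_z)\cdot\kappa_E\log\Big(\frac n\delta\Big)},\qquad Q_{k,\ell}\ge\sum_{(i,j)\in E,\,i<j}L_{i,j}B_{i,j}^2\,\big|(e_k-e_\ell)^\top L_z^\dagger(e_i-e_j)\big| .$$ Suppose that $Q_{k,\ell}\le 4B_{k,\ell}$ for all $(k,\ell)\in E$. Then, with probability at least $1-\delta$ (over the samples $y_{i,j}^{(\ell)}$), the optimization problem $\min_{\theta\in\mathbb R^n:\ \theta^\top 1_n=0}\mathcal L(\theta)$ admits a unique and finite minimizer $\theta^{\mathsf{MLE}}$, which satisfies for all $1\le k<\ell\le n$ $$\big|(\theta^{\mathsf{MLE}}_k-\theta^{\mathsf{MLE}}_\ell)-(\theta^\star_k-\theta^\star_\ell)\big|\le\begin{cases}B_{k,\ell}, & (k,\ell)\in E,\\ \tfrac12B_{k,\ell}+\tfrac18Q_{k,\ell}, & (k,\ell)\notin E.\end{cases}$$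
   Context: Model. $G=(V,E)$ is a connected undirected graph on $V=\{1,\dots,n\}$. The ground-truth score vector $\theta^\star\in\mathbb R^n$ satisfies $\sum_{i}\theta^\star_i=0$, and $\kappa_E\ge1$ is a finite number with $\max_{(i,j)\in E}|\theta^\star_i-\theta^\star_j|\le\log\kappa_E$. Let $\sigma(x)=1/(1+e^{-x})$. For each edge $(i,j)\in E$ with $i<j$ there are $L_{i,j}\ge1$ samples $y_{i,j}^{(1)},\dots,y_{i,j}^{(L_{i,j})}\in\{0,1\}$; all samples (over all edges) are independent and $\Pr(y_{i,j}^{(\ell)}=1)=1-\Pr(y_{i,j}^{(\ell)}=0)=\sigma(\theta^\star_i-\theta^\star_j)$. Negative log-likelihood: $$\mathcal L(\theta)=\sum_{(i,j)\in E,\,i<j}\ \sum_{1\le \ell\le L_{i,j}}\Big(-y_{i,j}^{(\ell)}(\theta_i-\theta_j)+\log(1+e^{\theta_i-\theta_j})\Big).$$ Notation. $e_i\in\mathbb R^n$ is the $i$-th standard basis vector, $1_n$ the all-one vector, $M^\dagger$ the pseudo-inverse of a symmetric matrix $M$. The Hessian of $\mathcal L$ at $\theta^\star$ is the weighted graph Laplacian $$L_z=\nabla^2\mathcal L(\theta^\star)=\sum_{(i,j)\in E,\,i<j}L_{i,j}z_{i,j}(e_i-e_j)(e_i-e_j)^\top,\qquad z_{i,j}=\sigma'(\theta^\star_i-\theta^\star_j)>0,$$ and $\Omega_{k,\ell}(L_z)=(e_k-e_\ell)^\top L_z^\dagger(e_k-e_\ell)$ is the effective resistance between $k$ and $\ell$.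 The graph, $\theta^\star$ and the $L_{i,j}$ are deterministic. *)

theory Defs
  imports
    "HOL-Probability.Probability"
    "Jordan_Normal_Form.Matrix"
    "Graph_Theory.Graph_Theory"
begin

unbundle no vec_syntax and no inner_syntax

text \<open>
  The number \<open>n\<close> of nodes is a value rather than a type, so that a universal constant can be
  quantified outside of it; vectors and matrices are those of \<^theory>\<open>Jordan_Normal_Form.Matrix\<close>,
  whose indices start at 0. The node set is therefore \<open>{0..<n}\<close>.
\<close>

definition sigmoid :: "real \<Rightarrow> real" where
  "sigmoid x = 1 / (1 + exp (- x))"

text \<open>The Moore--Penrose pseudo-inverse, as the unique solution of the four Penrose equations.\<close>

definition is_pseudo_inverse :: "real mat \<Rightarrow> real mat \<Rightarrow> bool" where
  "is_pseudo_inverse A X \<longleftrightarrow>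
     X \<in> carrier_mat (dim_col A) (dim_row A) \<and>
     A * X * A = A \<and> X * A * X = X \<and>
     transpose_mat (A * X) = A * X \<and> transpose_mat (X * A) = X * A"

definition pseudo_inverse :: "real mat \<Rightarrow> real mat" where
  "pseudo_inverse A = (THE X. is_pseudo_inverse A X)"

text \<open>
  An undirected simple graph is a symmetric loop-free digraph; each edge is counted once through
  its arc \<open>(i, j)\<close> with \<open>i < j\<close>.
\<close>

definition ordered_edges :: "nat pair_pre_digraph \<Rightarrow> (nat \<times> nat) set" where
  "ordered_edges G = {(i, j). (i, j) \<in> parcs G \<and> i < j}"

locale btl_model =
  fixes n :: nat
    and G :: "nat pair_pre_digraph"
    and L :: "nat \<Rightarrow> nat \<Rightarrow> nat"
    and \<theta>s :: "real vec"
    and \<kappa> :: real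
  assumes graph: "pair_graph G"
    and vertices: "pverts G = {0..<n}"
    and conn: "Digraph_Component.connected (with_proj G)"
    and samples_pos: "\<And>i j. (i, j) \<in> ordered_edges G \<Longrightarrow> 1 \<le> L i j"
    and score_dim: "\<theta>s \<in> carrier_vec n"
    and score_centered: "(\<Sum>i<n. \<theta>s $ i) = 0"
    and kappa_ge_1: "1 \<le> \<kappa>"
    and kappa_bound: "\<And>i j. (i, j) \<in> parcs G \<Longrightarrow> \<bar>\<theta>s $ i - \<theta>s $ j\<bar> \<le> ln \<kappa>"

definition sample_index :: "nat pair_pre_digraph \<Rightarrow> (nat \<Rightarrow> nat \<Rightarrow> nat) \<Rightarrow> (nat \<times> nat \<times> nat) set" where
  "sample_index G L = {(i, j, l). (i, j) \<in> ordered_edges G \<and> l \<in> {1..L i j}}"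

text \<open>
  The joint law of the independent samples; \<open>y (i, j, l)\<close> is the \<open>l\<close>-th outcome on the edge
  \<open>(i, j)\<close>, with \<open>True\<close> standing for 1. Entries outside the index set are \<open>False\<close> and never used.
\<close>

definition btl_samples ::
  "nat pair_pre_digraph \<Rightarrow> (nat \<Rightarrow> nat \<Rightarrow> nat) \<Rightarrow> real vec \<Rightarrow> (nat \<times> nat \<times> nat \<Rightarrow> bool) pmf" where
  "btl_samples G L \<theta>s =
     Pi_pmf (sample_index G L) False (\<lambda>(i, j, l). bernoulli_pmf (sigmoid (\<theta>s $ i - \<theta>s $ j)))"

definition neg_log_lik ::
  "nat pair_pre_digraph \<Rightarrow> (nat \<Rightarrow> nat \<Rightarrow> nat) \<Rightarrow> (nat \<times> nat \<times> nat \<Rightarrow> bool) \<Rightarrow> real vec \<Rightarrow> real" where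
  "neg_log_lik G L y \<theta> =
     (\<Sum>(i, j)\<in>ordered_edges G. \<Sum>l = 1..L i j.
        - of_bool (y (i, j, l)) * (\<theta> $ i - \<theta> $ j) + ln (1 + exp (\<theta> $ i - \<theta> $ j)))"

definition is_mle ::
  "nat \<Rightarrow> nat pair_pre_digraph \<Rightarrow> (nat \<Rightarrow> nat \<Rightarrow> nat) \<Rightarrow> (nat \<times> nat \<times> nat \<Rightarrow> bool) \<Rightarrow> real vec \<Rightarrow> bool" where
  "is_mle n G L y \<theta> \<longleftrightarrow>
     is_arg_min (neg_log_lik G L y) (\<lambda>\<theta>. \<theta> \<in> carrier_vec n \<and> (\<Sum>i<n. \<theta> $ i) = 0) \<theta>"

definition edge_vec :: "nat \<Rightarrow> nat \<Rightarrow> nat \<Rightarrow> real vec" where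
  "edge_vec n i j = unit_vec n i - unit_vec n j"

text \<open>The weighted Laplacian, written entrywise: the \<open>(a, b)\<close> entry of \<open>v v\<^sup>T\<close> is \<open>v\<^sub>a v\<^sub>b\<close>.\<close>

definition laplacian ::
  "nat \<Rightarrow> nat pair_pre_digraph \<Rightarrow> (nat \<Rightarrow> nat \<Rightarrow> nat) \<Rightarrow> real vec \<Rightarrow> real mat" where
  "laplacian n G L \<theta>s =
     mat n n (\<lambda>(a, b). \<Sum>(i, j)\<in>ordered_edges G.
       real (L i j) * deriv sigmoid (\<theta>s $ i - \<theta>s $ j) * (edge_vec n i j $ a * edge_vec n i j $ b))"

definition pinv_form :: "nat \<Rightarrow> real mat \<Rightarrow> nat \<times> nat \<Rightarrow> nat \<times> nat \<Rightarrow> real" where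
  "pinv_form n A = (\<lambda>(k, l) (i, j). edge_vec n k l \<bullet> (pseudo_inverse A *\<^sub>v edge_vec n i j))"

definition eff_resistance :: "nat \<Rightarrow> real mat \<Rightarrow> nat \<Rightarrow> nat \<Rightarrow> real" where
  "eff_resistance n A k l = pinv_form n A (k, l) (k, l)"

end

theory Submission
  imports Defs "Jordan_Normal_Form.Determinant"
begin

text \<open>
  Write \<open>\<theta> = \<theta>s + D\<close>. Linearising the score at \<open>\<theta>s\<close>, where the second derivative of the sigmoid
  is at most \<open>1/4\<close>, stationarity becomes the fixed point equation \<open>D = \<Phi> D\<close> with
  \<open>\<Phi> D = L\<^sub>z\<^sup>\<dagger> (noise + remainder)\<close>, the remainder on an edge being at most \<open>L\<^sub>i\<^sub>j (D\<^sub>i - D\<^sub>j)\<^sup>2 / 8\<close>.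
  Hoeffding's inequality and a union bound make the noise part of each difference
  \<open>(\<Phi> D)\<^sub>k - (\<Phi> D)\<^sub>l\<close> at most \<open>B\<^sub>k\<^sub>l / 2\<close>; on the edges \<open>B\<^sub>k\<^sub>l / 2 + Q\<^sub>k\<^sub>l / 8 \<le> B\<^sub>k\<^sub>l\<close>, so the compact convex
  set given by \<open>\<bar>D\<^sub>k - D\<^sub>l\<bar> \<le> B\<^sub>k\<^sub>l / 2 + Q\<^sub>k\<^sub>l / 8\<close> is mapped into itself. No fixed point theorem is
  needed: at a minimiser \<open>D\<close> of the likelihood over this set the direction \<open>\<Phi> D - D\<close> is feasible,
  and the derivative along it is \<open>- (\<Phi> D - D)\<^sup>T L\<^sub>z (\<Phi> D - D)\<close>. Hence \<open>\<Phi> D = D\<close> up to constants, and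
  strict convexity turns this stationary point into the unique global minimiser.
\<close>

section \<open>The logistic function\<close>

lemma sigmoid_bounds: "0 < sigmoid x" "sigmoid x < 1"
proof -
  have "0 < 1 + exp (- x)" by (simp add: add_pos_pos)
  then show "0 < sigmoid x" "sigmoid x < 1" by (auto simp: sigmoid_def)
qed

lemma DERIV_sigmoid: "(sigmoid has_real_derivative sigmoid x * (1 - sigmoid x)) (at x)"
proof -
  have *: "1 + exp (- x) \<noteq> 0" by (smt (verit) exp_gt_zero)
  have "((\<lambda>x. 1 / (1 + exp (- x))) has_real_derivative exp (- x) / (1 + exp (- x))\<^sup>2) (at x)"
    using * by (auto intro!: derivative_eq_intros simp: power2_eq_square)
  moreover have "exp (- x) / (1 + exp (- x))\<^sup>2 = sigmoid x * (1 - sigmoid x)"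
    using * by (simp add: sigmoid_def field_simps power2_eq_square)
  moreover have "sigmoid = (\<lambda>x. 1 / (1 + exp (- x)))"
    by (simp add: fun_eq_iff sigmoid_def)
  ultimately show ?thesis by simp
qed

lemma deriv_sigmoid: "deriv sigmoid x = sigmoid x * (1 - sigmoid x)"
  by (rule DERIV_imp_deriv[OF DERIV_sigmoid])

lemma strict_mono_sigmoid: "strict_mono sigmoid"
proof
  fix x y :: real assume "x < y"
  moreover have "0 < 1 + exp (- y)" by (simp add: add_pos_pos)
  ultimately show "sigmoid x < sigmoid y"
    unfolding sigmoid_def by (intro divide_strict_left_mono) (auto intro!: mult_pos_pos add_pos_pos)
qed

lemma DERIV_softplus: "((\<lambda>x. ln (1 + exp x)) has_real_derivative sigmoid x) (at x)"
proof -
  have *: "0 < 1 + exp x" "1 + exp x \<noteq> 0" "1 + exp (- x) \<noteq> 0"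
    by (smt (verit) exp_gt_zero)+
  have "((\<lambda>x. ln (1 + exp x)) has_real_derivative exp x / (1 + exp x)) (at x)"
    using * by (auto intro!: derivative_eq_intros)
  moreover have "exp x / (1 + exp x) = sigmoid x"
    using * by (simp add: sigmoid_def exp_minus divide_simps)
  ultimately show ?thesis by simp
qed

text \<open>Strict convexity via the mean value theorem: the chord slope is \<open>sigmoid c\<close>
  at an intermediate \<open>c\<close>, and \<open>sigmoid\<close> is strictly increasing, so the
  comparison with the tangent slope is strict on either side of \<open>a\<close>.\<close>

lemma softplus_above_tangent:
  assumes "b \<noteq> a"
  shows "ln (1 + exp a) + sigmoid a * (b - a) < ln (1 + exp b)"
proof (cases "a < b")
  case True
  obtain c where "a < c" "c < b" "ln (1 + exp b) - ln (1 + exp a) = (b - a) * sigmoid c"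
    using MVT2[OF True, of "\<lambda>x. ln (1 + exp x)" sigmoid] DERIV_softplus by blast
  moreover from this have "(b - a) * sigmoid a < (b - a) * sigmoid c"
    using strict_monoD[OF strict_mono_sigmoid, of a c] by (intro mult_strict_left_mono) auto
  ultimately show ?thesis by (simp add: algebra_simps)
next
  case False
  then have "b < a" using assms by simp
  then obtain c where "b < c" "c < a" "ln (1 + exp a) - ln (1 + exp b) = (a - b) * sigmoid c"
    using MVT2[OF \<open>b < a\<close>, of "\<lambda>x. ln (1 + exp x)" sigmoid] DERIV_softplus by blast
  moreover from this have "(a - b) * sigmoid c < (a - b) * sigmoid a"
    using strict_monoD[OF strict_mono_sigmoid, of c a] by (intro mult_strict_left_mono) auto
  ultimately show ?thesis by (simp add: algebra_simps)
qed

text \<open>Taylor's formula of order 2 with Lagrange remainder. The second derivative is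
  \<sigma>(1-\<sigma>)(1-2\<sigma>), whose absolute value is at most 1/4; halving it gives the
  constant 1/8, which is the 1/8 in front of \<open>Q\<close> in the final bound.\<close>

lemma sigmoid_linearization:
  "\<bar>sigmoid (a + d) - sigmoid a - deriv sigmoid a * d\<bar> \<le> d\<^sup>2 / 8"
proof (cases "d = 0")
  case False
  define s'' where "s'' x = sigmoid x * (1 - sigmoid x) * (1 - 2 * sigmoid x)" for x
  \<comment> \<open>\<open>Taylor\<close> expects the successive derivatives as one family indexed
    by the order, and an endpoint different from the centre; hence the list lookup and the separate
    case \<open>d = 0\<close>.\<close>
  define S where "S = (\<lambda>m. [sigmoid, \<lambda>x. sigmoid x * (1 - sigmoid x), s''] ! m)"
  have "((\<lambda>x. sigmoid x * (1 - sigmoid x)) has_real_derivative s'' x) (at x)" for x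
    unfolding s''_def by (auto intro!: derivative_eq_intros DERIV_sigmoid simp: algebra_simps)
  then have "\<forall>m t. m < 2 \<and> min a (a + d) \<le> t \<and> t \<le> max a (a + d) \<longrightarrow>
      (S m has_real_derivative S (Suc m) t) (at t)"
    using DERIV_sigmoid by (auto simp: S_def less_Suc_eq numeral_2_eq_2)
  from Taylor[of 2 S sigmoid, OF _ _ this, of a "a + d"] False
  obtain t where "sigmoid (a + d) = sigmoid a + sigmoid a * (1 - sigmoid a) * d + s'' t / 2 * d\<^sup>2"
    by (auto simp: S_def lessThan_nat_numeral)
  then have eq: "sigmoid (a + d) - sigmoid a - deriv sigmoid a * d = s'' t / 2 * d\<^sup>2"
    by (simp add: deriv_sigmoid)
  have "\<bar>sigmoid t * (1 - sigmoid t)\<bar> \<le> 1 / 4"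
    using mult_const_minus_self_real_le[of "sigmoid t" 1] sigmoid_bounds[of t] by (simp add: abs_mult)
  then have "\<bar>s'' t\<bar> \<le> 1 / 4 * 1"
    unfolding s''_def abs_mult[of _ "1 - 2 * _"]
    using sigmoid_bounds[of t] by (intro mult_mono) (auto simp: abs_le_iff)
  then have "\<bar>s'' t\<bar> / 2 * d\<^sup>2 \<le> 1 / 8 * d\<^sup>2"
    by (intro mult_right_mono) auto
  then show ?thesis unfolding eq by (simp add: abs_mult)
qed simp

text \<open>The derivative equals 1/(2 + exp x + exp (-x)); both exponentials are at most \<kappa>,
  and 2 \<le> 2\<kappa>, so the denominator is at most 4\<kappa>.\<close>

lemma deriv_sigmoid_lower_bound:
  assumes "\<bar>x\<bar> \<le> ln \<kappa>" "1 \<le> \<kappa>"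
  shows "1 / (4 * \<kappa>) \<le> deriv sigmoid x"
proof -
  have "exp x \<le> exp (ln \<kappa>)" "exp (- x) \<le> exp (ln \<kappa>)" using assms(1) by auto
  then have le: "exp x \<le> \<kappa>" "exp (- x) \<le> \<kappa>" using assms(2) by auto
  have pos: "0 < 1 + exp (- x)" by (simp add: add_pos_pos)
  have pos': "2 + exp x + exp (- x) \<noteq> 0" by (smt (verit) exp_gt_zero)
  have "deriv sigmoid x = exp (- x) / (1 + exp (- x))\<^sup>2"
    unfolding deriv_sigmoid using pos by (simp add: sigmoid_def field_simps power2_eq_square)
  also have "\<dots> = 1 / (2 + exp x + exp (- x))"
    using pos pos' by (simp add: divide_simps power2_eq_square) (simp add: algebra_simps flip: exp_add)
  also have "1 / (4 * \<kappa>) \<le> \<dots>"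
    using le assms(2) by (intro divide_left_mono) (auto intro!: mult_pos_pos add_pos_pos)
  finally show ?thesis .
qed

section \<open>Pseudo-inverses\<close>

text \<open>Both \<open>A * X\<close> and \<open>A * Y\<close> are the orthogonal projection onto
  the range of \<open>A\<close>, so they agree, and likewise \<open>X * A = Y * A\<close>. Then X =
  XAX = YAX = YAY = Y.\<close>

lemma is_pseudo_inverse_unique:
  assumes X: "is_pseudo_inverse A X" and Y: "is_pseudo_inverse A Y"
  shows "X = Y"
proof -
  define p q where "p = dim_row A" and "q = dim_col A"
  have A: "A \<in> carrier_mat p q" and cX: "X \<in> carrier_mat q p" and cY: "Y \<in> carrier_mat q p"
    using X Y by (auto simp: is_pseudo_inverse_def p_def q_def)
  \<comment> \<open>Carriers and associativity are instantiated for every rectangular shape that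
    occurs, so that the simplifier can rebracket the products freely.\<close>
  note c = A cX cY mult_carrier_mat[of _ p q _ p] mult_carrier_mat[of _ q p _ q]
    mult_carrier_mat[of _ p p _ q] mult_carrier_mat[of _ q p _ p] mult_carrier_mat[of _ p p _ p]
    mult_carrier_mat[of _ q q _ p] mult_carrier_mat[of _ q q _ q]
  note assoc = assoc_mult_mat[of _ p q _ p _ q] assoc_mult_mat[of _ p q _ p _ p] assoc_mult_mat[of _ p q _ q _ p]
    assoc_mult_mat[of _ q p _ q _ p] assoc_mult_mat[of _ q p _ q _ q] assoc_mult_mat[of _ p p _ q _ p]
    assoc_mult_mat[of _ q q _ p _ q] assoc_mult_mat[of _ q q _ q _ p] assoc_mult_mat[of _ p p _ q _ q]
  have "A * X = A * Y * A * X"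
    using Y by (simp add: is_pseudo_inverse_def)
  also have "\<dots> = (A * Y) * (A * X)"
    using c by (simp add: assoc)
  also have "\<dots> = transpose_mat (A * Y) * transpose_mat (A * X)"
    using X Y by (simp add: is_pseudo_inverse_def)
  also have "\<dots> = transpose_mat ((A * X) * (A * Y))"
    using c by (simp add: transpose_mult[of _ p p _ p])
  also have "(A * X) * (A * Y) = A * X * A * Y"
    using c by (simp add: assoc)
  also have "\<dots> = A * Y"
    using X by (simp add: is_pseudo_inverse_def)
  also have "transpose_mat (A * Y) = A * Y"
    using Y by (simp add: is_pseudo_inverse_def)
  finally have AX: "A * X = A * Y" .
  have "X * A = X * (A * Y * A)"
    using Y by (simp add: is_pseudo_inverse_def)
  also have "\<dots> = (X * A) * (Y * A)"
    using c by (simp add: assoc)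
  also have "\<dots> = transpose_mat (X * A) * transpose_mat (Y * A)"
    using X Y by (simp add: is_pseudo_inverse_def)
  also have "\<dots> = transpose_mat ((Y * A) * (X * A))"
    using c by (simp add: transpose_mult[of _ q q _ q])
  also have "(Y * A) * (X * A) = Y * (A * X * A)"
    using c by (simp add: assoc)
  also have "\<dots> = Y * A"
    using X by (simp add: is_pseudo_inverse_def)
  also have "transpose_mat (Y * A) = Y * A"
    using Y by (simp add: is_pseudo_inverse_def)
  finally have XA: "X * A = Y * A" .
  have "X = X * A * X" using X by (simp add: is_pseudo_inverse_def)
  also have "\<dots> = Y * (A * X)"
    unfolding XA using c by (simp add: assoc)
  also have "\<dots> = Y * A * Y"
    unfolding AX using c by (simp add: assoc)
  also have "\<dots> = Y" using Y by (simp add: is_pseudo_inverse_def)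
  finally show ?thesis .
qed

lemma pseudo_inverse_eqI: "is_pseudo_inverse A X \<Longrightarrow> pseudo_inverse A = X"
  unfolding pseudo_inverse_def using is_pseudo_inverse_unique by blast

lemma add_eq_imp_eq_minus_mat:
  fixes A B C :: "'a :: group_add mat"
  assumes "A \<in> carrier_mat n m" "B \<in> carrier_mat n m" and "A + B = C"
  shows "A = C - B"
  using assms by (intro eq_matI) auto

text \<open>If \<open>J\<close> is the orthogonal projection onto the kernel of \<open>A\<close>, then \<open>(A + J)\<^sup>-\<^sup>1 - J\<close> is the
  pseudo-inverse of \<open>A\<close>.\<close>

lemma pseudo_inverse_kernel_projection:
  assumes A: "A \<in> carrier_mat n n" and J: "J \<in> carrier_mat n n"
    and AJ: "A * J = 0\<^sub>m n n" and JA: "J * A = 0\<^sub>m n n" and JJ: "J * J = J"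
    and JT: "transpose_mat J = J" and det: "det (A + J) \<noteq> 0"
  shows "pseudo_inverse A \<in> carrier_mat n n"
    and "A * pseudo_inverse A = 1\<^sub>m n - J" and "pseudo_inverse A * A = 1\<^sub>m n - J"
proof -
  have M: "A + J \<in> carrier_mat n n" using A J by simp
  from det_non_zero_imp_unit[OF M det, of "()"]
  obtain N where N: "N \<in> carrier_mat n n" and NM: "N * (A + J) = 1\<^sub>m n" and MN: "(A + J) * N = 1\<^sub>m n"
    by (auto simp: Units_def ring_mat_simps)
  \<comment> \<open>\<open>A + J\<close> acts as the identity on the columns of \<open>J\<close>,
    hence so does its inverse \<open>N\<close>; the mirrored argument gives
    \<open>J * N = J\<close>.\<close>
  have NJ: "N * J = J"
  proof -
    have "(A + J) * J = J" using A J AJ JJ by (simp add: add_mult_distrib_mat[of _ n n])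
    then have "N * J = N * ((A + J) * J)" by simp
    also have "\<dots> = (N * (A + J)) * J"
      using N M J by (simp add: assoc_mult_mat[of _ n n _ n _ n])
    finally show ?thesis using NM J by simp
  qed
  have JN: "J * N = J"
  proof -
    have "J * (A + J) = J" using A J JA JJ by (simp add: mult_add_distrib_mat[of _ n n])
    then have "J * N = J * (A + J) * N" by simp
    also have "\<dots> = J * ((A + J) * N)"
      using N M J by (simp add: assoc_mult_mat[of _ n n _ n _ n])
    finally show ?thesis using MN J by simp
  qed
  have AN: "A * N = 1\<^sub>m n - J"
  proof -
    have "A * N + J = 1\<^sub>m n" using MN A J N JN by (simp add: add_mult_distrib_mat[of _ n n])
    then show ?thesis using A J N by (intro add_eq_imp_eq_minus_mat) auto
  qed
  have NA: "N * A = 1\<^sub>m n - J"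
  proof -
    have "N * A + J = 1\<^sub>m n" using NM A J N NJ by (simp add: mult_add_distrib_mat[of _ n n])
    then show ?thesis using A J N by (intro add_eq_imp_eq_minus_mat) auto
  qed
  define X where "X = N - J"
  have X: "X \<in> carrier_mat n n" using N J by (auto simp: X_def)
  have AX: "A * X = 1\<^sub>m n - J"
    unfolding X_def using A N J AN AJ by (subst mult_minus_distrib_mat[of _ n n]) auto
  have XA: "X * A = 1\<^sub>m n - J"
    unfolding X_def using A N J NA JA by (subst minus_mult_distrib_mat[of _ n n]) auto
  have "is_pseudo_inverse A X"
    unfolding is_pseudo_inverse_def
  proof (intro conjI)
    show "X \<in> carrier_mat (dim_col A) (dim_row A)" using X A by auto
    show "A * X * A = A"
      unfolding AX using A J JA by (subst minus_mult_distrib_mat[of _ n n]) auto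
    have "J * X = 0\<^sub>m n n"
      unfolding X_def using N J JN JJ by (subst mult_minus_distrib_mat[of _ n n]) auto
    then show "X * A * X = X"
      unfolding XA using X J by (subst minus_mult_distrib_mat[of _ n n]) auto
    show "transpose_mat (A * X) = A * X" "transpose_mat (X * A) = X * A"
      unfolding AX XA using JT J by (auto simp: transpose_minus[of _ n n])
  qed
  then have "pseudo_inverse A = X" by (rule pseudo_inverse_eqI)
  then show "pseudo_inverse A \<in> carrier_mat n n"
    "A * pseudo_inverse A = 1\<^sub>m n - J" "pseudo_inverse A * A = 1\<^sub>m n - J"
    using X AX XA by auto
qed

section \<open>The Laplacian of the model\<close>

context btl_model
begin

section \<open>Edges and connectivity of the graph\<close>

lemma ordered_edges_subset: "ordered_edges G \<subseteq> parcs G"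
  by (auto simp: ordered_edges_def)

lemma parcs_less:
  assumes "(i, j) \<in> parcs G"
  shows "i < n" "j < n" "i \<noteq> j"
proof -
  interpret pair_graph G by (rule graph)
  show "i < n" "j < n" using wellformed[OF assms] vertices by auto
  show "i \<noteq> j" using assms no_loops' by blast
qed

lemma parcs_sym: "(i, j) \<in> parcs G \<Longrightarrow> (j, i) \<in> parcs G"
proof -
  interpret pair_graph G by (rule graph)
  show "(i, j) \<in> parcs G \<Longrightarrow> (j, i) \<in> parcs G" using arcs_symmetric by blast
qed

lemma finite_ordered_edges: "finite (ordered_edges G)"
  by (rule finite_subset[of _ "{..<n} \<times> {..<n}"])
    (auto simp: ordered_edges_def dest: parcs_less)

lemma n_pos: "0 < n"
  using conn vertices by (auto simp: connected_def strongly_connected_def)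

text \<open>Equality propagates along a path joining the two nodes. Connectedness speaks of the
  symmetric closure, so a step of the path may use an arc in either direction.\<close>

lemma const_if_const_on_edges:
  fixes u :: "nat \<Rightarrow> 'a"
  assumes u: "\<And>i j. (i, j) \<in> ordered_edges G \<Longrightarrow> u i = u j" and "k < n" "l < n"
  shows "u k = u l"
proof -
  have edge: "u i = u j" if "(i, j) \<in> parcs G" for i j
  proof (cases "i < j")
    case True
    then show ?thesis using u that by (simp add: ordered_edges_def)
  next
    case False
    then have "(j, i) \<in> ordered_edges G"
      using parcs_sym[OF that] parcs_less(3)[OF that] by (simp add: ordered_edges_def)
    then show ?thesis using u by metis
  qed
  have "k \<rightarrow>\<^sup>*\<^bsub>with_proj (mk_symmetric (with_proj G))\<^esub> l"
    using conn vertices \<open>k < n\<close> \<open>l < n\<close> by (auto simp: connected_def strongly_connected_def)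
  then have "(k, l) \<in> (arcs_ends (with_proj (mk_symmetric (with_proj G))))\<^sup>*"
    by (rule reachable_rtranclI)
  then show ?thesis
  proof (induction rule: rtrancl_induct)
    case (step x y)
    then have "(x, y) \<in> parcs G \<or> (y, x) \<in> parcs G"
      by (auto simp: parcs_mk_symmetric arcs_ends_def arc_to_ends_def)
    then show ?case using edge step by metis
  qed simp
qed

section \<open>The energy form of the weighted Laplacian\<close>

definition edge_weight :: "nat \<times> nat \<Rightarrow> real" where
  "edge_weight = (\<lambda>(i, j). real (L i j) * deriv sigmoid (\<theta>s $ i - \<theta>s $ j))"

lemma edge_weight_pos: "e \<in> ordered_edges G \<Longrightarrow> 0 < edge_weight e"
  using samples_pos sigmoid_bounds
  by (force simp: edge_weight_def deriv_sigmoid intro!: mult_pos_pos split: prod.splits)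

abbreviation Lz :: "real mat" where
  "Lz \<equiv> laplacian n G L \<theta>s"

text \<open>Score vectors are handled as functions on nodes and edges as single pairs, so that
  quadratic forms become sums over \<open>ordered_edges G\<close>.\<close>

abbreviation edge_diff :: "(nat \<Rightarrow> real) \<Rightarrow> nat \<times> nat \<Rightarrow> real" where
  "edge_diff u e \<equiv> u (fst e) - u (snd e)"

lemma Lz_carrier [simp]: "Lz \<in> carrier_mat n n" "dim_row Lz = n" "dim_col Lz = n"
  by (auto simp: laplacian_def)

lemma edge_vec_index: "i < n \<Longrightarrow> j < n \<Longrightarrow> a < n \<Longrightarrow> edge_vec n i j $ a = of_bool (a = i) - of_bool (a = j)"
  by (auto simp: edge_vec_def)

lemma sum_edge_vec:
  assumes "i < n" "j < n"
  shows "(\<Sum>a<n. u a * edge_vec n i j $ a) = u i - u j"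
proof -
  have "(\<Sum>a<n. u a * edge_vec n i j $ a) =
      (\<Sum>a<n. (if a = i then u a else 0) - (if a = j then u a else 0))"
    using assms by (intro sum.cong) (auto simp: edge_vec_index)
  then show ?thesis using assms by (simp add: sum_subtractf)
qed

lemma Lz_index:
  "a < n \<Longrightarrow> b < n \<Longrightarrow> Lz $$ (a, b) =
    (\<Sum>e\<in>ordered_edges G. edge_weight e * (edge_vec n (fst e) (snd e) $ a * edge_vec n (fst e) (snd e) $ b))"
  by (simp add: laplacian_def edge_weight_def case_prod_beta)

lemma Lz_sym: "a < n \<Longrightarrow> b < n \<Longrightarrow> Lz $$ (a, b) = Lz $$ (b, a)"
  by (simp add: Lz_index mult.commute)

text \<open>\<open>Lz\<close> is a sum of rank-one terms \<open>edge_weight e\<close> times v v^T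
  with v an edge vector, and pairing u with v gives the difference of u along the edge. Exchanging
  sums turns the bilinear form into the Dirichlet form of the graph.\<close>

lemma Lz_energy:
  "(\<Sum>a<n. u a * (\<Sum>b<n. Lz $$ (a, b) * v b)) =
    (\<Sum>e\<in>ordered_edges G. edge_weight e * (edge_diff u e * edge_diff v e))"
proof -
  define V where "V e = edge_vec n (fst e) (snd e)" for e
  have "(\<Sum>a<n. u a * (\<Sum>b<n. Lz $$ (a, b) * v b)) =
      (\<Sum>a<n. \<Sum>b<n. \<Sum>e\<in>ordered_edges G. edge_weight e * ((u a * V e $ a) * (v b * V e $ b)))"
    by (simp add: Lz_index V_def sum_distrib_left sum_distrib_right mult_ac)
  also have "\<dots> = (\<Sum>a<n. \<Sum>e\<in>ordered_edges G. \<Sum>b<n. edge_weight e * ((u a * V e $ a) * (v b * V e $ b)))"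
    by (intro sum.cong refl sum.swap)
  also have "\<dots> = (\<Sum>e\<in>ordered_edges G. \<Sum>a<n. \<Sum>b<n. edge_weight e * ((u a * V e $ a) * (v b * V e $ b)))"
    by (rule sum.swap)
  also have "\<dots> = (\<Sum>e\<in>ordered_edges G. edge_weight e * ((\<Sum>a<n. u a * V e $ a) * (\<Sum>b<n. v b * V e $ b)))"
    unfolding sum_product by (simp only: sum_distrib_left)
  also have "\<dots> = (\<Sum>e\<in>ordered_edges G. edge_weight e * (edge_diff u e * edge_diff v e))"
  proof (rule sum.cong[OF refl])
    fix e assume "e \<in> ordered_edges G"
    then have "fst e < n" "snd e < n"
      using parcs_less[of "fst e" "snd e"] ordered_edges_subset by auto
    then show "edge_weight e * ((\<Sum>a<n. u a * V e $ a) * (\<Sum>b<n. v b * V e $ b)) =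
        edge_weight e * (edge_diff u e * edge_diff v e)"
      by (simp add: sum_edge_vec V_def)
  qed
  finally show ?thesis .
qed

text \<open>All terms are nonnegative and all weights positive, so a nonpositive energy forces every
  term to vanish.\<close>

lemma energy_zero_imp_edge_diff_zero:
  assumes "(\<Sum>e\<in>ordered_edges G. edge_weight e * (edge_diff u e * edge_diff u e)) \<le> 0"
    and e: "e \<in> ordered_edges G"
  shows "edge_diff u e = 0"
proof -
  have nn: "0 \<le> edge_weight e * (edge_diff u e * edge_diff u e)" if "e \<in> ordered_edges G" for e
    using edge_weight_pos[OF that] by simp
  then have "(\<Sum>e\<in>ordered_edges G. edge_weight e * (edge_diff u e * edge_diff u e)) = 0"
    using assms(1) by (meson antisym sum_nonneg)
  then have "edge_weight e * (edge_diff u e * edge_diff u e) = 0"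
    using sum_nonneg_eq_0_iff[OF finite_ordered_edges,
        of "\<lambda>e. edge_weight e * (edge_diff u e * edge_diff u e)"] nn e by blast
  then show ?thesis using edge_weight_pos[OF e] by simp
qed

text \<open>The orthogonal projection onto the constant vectors, which form the kernel of
  \<open>Lz\<close> because the graph is connected; it serves as \<open>J\<close> in
  \<open>pseudo_inverse_kernel_projection\<close>.\<close>

definition avg_mat :: "real mat" where
  "avg_mat = mat n n (\<lambda>_. 1 / real n)"

lemma avg_mat_simps [simp]:
  "avg_mat \<in> carrier_mat n n" "dim_row avg_mat = n" "dim_col avg_mat = n"
  "a < n \<Longrightarrow> b < n \<Longrightarrow> avg_mat $$ (a, b) = 1 / real n"
  by (auto simp: avg_mat_def)

lemma mult_mat_index_sum:
  "A \<in> carrier_mat n n \<Longrightarrow> B \<in> carrier_mat n n \<Longrightarrow> a < n \<Longrightarrow> b < n \<Longrightarrow>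
    (A * B) $$ (a, b) = (\<Sum>c<n. A $$ (a, c) * B $$ (c, b))"
  by (auto simp: scalar_prod_def atLeast0LessThan intro!: sum.cong)

text \<open>Pair the indicator of \<open>a\<close> with the constant 1 in the energy form: a
  constant has no edge differences.\<close>

lemma Lz_row_sum: "a < n \<Longrightarrow> (\<Sum>b<n. Lz $$ (a, b)) = 0"
  using Lz_energy[of "\<lambda>c. of_bool (c = a)" "\<lambda>_. 1"]
  by (simp add: of_bool_def if_distrib[of "\<lambda>x. x * _"] cong: if_cong)

lemma Lz_col_sum: "b < n \<Longrightarrow> (\<Sum>a<n. Lz $$ (a, b)) = 0"
  using Lz_row_sum[of b] sum.cong[of "{..<n}" "{..<n}" "\<lambda>a. Lz $$ (a, b)" "\<lambda>a. Lz $$ (b, a)"]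
    Lz_sym by simp

text \<open>Pairing a kernel vector \<open>v\<close> with its equation gives energy plus S^2/n equal
  to 0, where S is the sum of the entries. Both parts vanish, so \<open>v\<close> is constant by
  connectivity and has sum 0, hence is zero.\<close>

lemma det_Lz_plus_avg: "det (Lz + avg_mat) \<noteq> 0"
proof
  assume "det (Lz + avg_mat) = 0"
  then obtain v where v: "v \<in> carrier_vec n" "v \<noteq> 0\<^sub>v n" and z: "(Lz + avg_mat) *\<^sub>v v = 0\<^sub>v n"
    using det_0_iff_vec_prod_zero[of "Lz + avg_mat" n] by auto
  define S where "S = (\<Sum>b<n. v $ b)"
  have row: "(\<Sum>b<n. Lz $$ (a, b) * v $ b) = - S / n" if "a < n" for a
  proof -
    have "((Lz + avg_mat) *\<^sub>v v) $ a = (\<Sum>b<n. (Lz $$ (a, b) + 1 / n) * v $ b)"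
      using v that by (auto simp: scalar_prod_def atLeast0LessThan intro!: sum.cong)
    also have "\<dots> = (\<Sum>b<n. Lz $$ (a, b) * v $ b) + S / n"
      by (simp add: S_def distrib_right sum.distrib sum_divide_distrib)
    finally show ?thesis using z that by simp
  qed
  have "(\<Sum>e\<in>ordered_edges G. edge_weight e * (edge_diff (($) v) e * edge_diff (($) v) e)) =
      (\<Sum>a<n. v $ a * (- S / n))"
    unfolding Lz_energy[symmetric] by (intro sum.cong refl) (simp add: row)
  also have "\<dots> = S * (- S / n)"
    unfolding S_def by (rule sum_distrib_right[symmetric])
  also have "\<dots> = - S\<^sup>2 / n"
    by (simp add: power2_eq_square)
  finally have eq: "(\<Sum>e\<in>ordered_edges G. edge_weight e * (edge_diff (($) v) e * edge_diff (($) v) e)) = - S\<^sup>2 / n" .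
  then have edge: "edge_diff (($) v) e = 0" if "e \<in> ordered_edges G" for e
    using that by (intro energy_zero_imp_edge_diff_zero) auto
  with eq have "S = 0" using n_pos by simp
  have const: "v $ a = v $ 0" if "a < n" for a
  proof (rule const_if_const_on_edges)
    show "v $ i = v $ j" if "(i, j) \<in> ordered_edges G" for i j
      using edge[OF that] by simp
  qed (use that n_pos in auto)
  have "S = (\<Sum>b<n. v $ 0)" unfolding S_def by (intro sum.cong refl const) simp
  with \<open>S = 0\<close> n_pos have "v $ 0 = 0" by simp
  with const v show False by (metis carrier_vecD eq_vecI index_zero_vec(1) index_zero_vec(2))
qed

section \<open>The pseudo-inverse of the Laplacian and its entries\<close>

abbreviation Linv :: "real mat" where
  "Linv \<equiv> pseudo_inverse Lz"

lemma Linv: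
  shows Linv_carrier: "Linv \<in> carrier_mat n n"
    and Lz_Linv: "Lz * Linv = 1\<^sub>m n - avg_mat" and Linv_Lz: "Linv * Lz = 1\<^sub>m n - avg_mat"
proof -
  have "Lz * avg_mat = 0\<^sub>m n n"
    by (rule eq_matI)
      (simp_all add: mult_mat_index_sum Lz_row_sum del: index_mult_mat(1) flip: sum_divide_distrib)
  moreover have "avg_mat * Lz = 0\<^sub>m n n"
    by (rule eq_matI)
      (simp_all add: mult_mat_index_sum Lz_col_sum del: index_mult_mat(1) flip: sum_divide_distrib)
  moreover have "avg_mat * avg_mat = avg_mat"
    by (rule eq_matI) (simp_all add: mult_mat_index_sum del: index_mult_mat(1))
  moreover have "transpose_mat avg_mat = avg_mat"
    by (rule eq_matI) auto
  ultimately show "Linv \<in> carrier_mat n n" "Lz * Linv = 1\<^sub>m n - avg_mat"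
    "Linv * Lz = 1\<^sub>m n - avg_mat"
    using pseudo_inverse_kernel_projection[of Lz n avg_mat] det_Lz_plus_avg by auto
qed

lemma Lz_Linv_index:
  "a < n \<Longrightarrow> b < n \<Longrightarrow> (\<Sum>c<n. Lz $$ (a, c) * Linv $$ (c, b)) = of_bool (a = b) - 1 / n"
  using mult_mat_index_sum[OF Lz_carrier(1) Linv_carrier, of a b]
  by (cases "a = b") (simp_all add: Lz_Linv)

lemma Linv_Lz_index:
  "a < n \<Longrightarrow> b < n \<Longrightarrow> (\<Sum>c<n. Linv $$ (a, c) * Lz $$ (c, b)) = of_bool (a = b) - 1 / n"
  using mult_mat_index_sum[OF Linv_carrier Lz_carrier(1), of a b]
  by (cases "a = b") (simp_all add: Linv_Lz)

lemma pinv_form_eq: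
  assumes "k < n" "l < n" "i < n" "j < n"
  shows "pinv_form n Lz (k, l) (i, j) =
    (Linv $$ (k, i) - Linv $$ (k, j)) - (Linv $$ (l, i) - Linv $$ (l, j))"
proof -
  have [simp]: "dim_vec (edge_vec n i j) = n" for i j by (simp add: edge_vec_def)
  have "(Linv *\<^sub>v edge_vec n i j) $ a = (\<Sum>b<n. Linv $$ (a, b) * edge_vec n i j $ b)" if "a < n" for a
    using that Linv_carrier by (auto simp: scalar_prod_def atLeast0LessThan intro!: sum.cong)
  then have "(Linv *\<^sub>v edge_vec n i j) $ a = Linv $$ (a, i) - Linv $$ (a, j)" if "a < n" for a
    using that assms by (simp add: sum_edge_vec)
  then have "pinv_form n Lz (k, l) (i, j) =
      (\<Sum>a<n. (Linv $$ (a, i) - Linv $$ (a, j)) * edge_vec n k l $ a)"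
    using Linv_carrier
    by (auto simp: pinv_form_def scalar_prod_def atLeast0LessThan mult.commute intro!: sum.cong)
  then show ?thesis using assms by (simp add: sum_edge_vec)
qed

section \<open>Responses to edge flows, and the effective resistance\<close>

text \<open>The solution \<open>Linv (\<Sum>\<^sub>e w\<^sub>e (e\<^sub>i - e\<^sub>j))\<close> of the Laplace equation whose right-hand side
  is the divergence of \<open>w\<close>.\<close>

definition response :: "(nat \<times> nat \<Rightarrow> real) \<Rightarrow> nat \<Rightarrow> real" where
  "response w a = (\<Sum>e\<in>ordered_edges G. w e * (Linv $$ (a, fst e) - Linv $$ (a, snd e)))"

lemma response_diff:
  assumes "k < n" "l < n"
  shows "response w k - response w l = (\<Sum>e\<in>ordered_edges G. w e * pinv_form n Lz (k, l) e)"
  unfolding response_def sum_subtractf[symmetric]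
proof (intro sum.cong refl)
  fix e assume "e \<in> ordered_edges G"
  then have "fst e < n" "snd e < n"
    using parcs_less[of "fst e" "snd e"] ordered_edges_subset by auto
  then have "pinv_form n Lz (k, l) e =
      (Linv $$ (k, fst e) - Linv $$ (k, snd e)) - (Linv $$ (l, fst e) - Linv $$ (l, snd e))"
    using pinv_form_eq[of k l "fst e" "snd e"] assms by simp
  then show "w e * (Linv $$ (k, fst e) - Linv $$ (k, snd e)) - w e * (Linv $$ (l, fst e) - Linv $$ (l, snd e))
      = w e * pinv_form n Lz (k, l) e"
    by (simp only:) (simp add: algebra_simps)
qed

text \<open>\<open>Lz * Linv\<close> is the identity minus \<open>avg_mat\<close>, and
  \<open>avg_mat\<close> annihilates edge vectors. So \<open>Lz\<close> maps the response exactly to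
  the divergence of \<open>w\<close>, and this is that equation tested against
  \<open>u\<close>.\<close>

lemma response_weak:
  "(\<Sum>e\<in>ordered_edges G. edge_weight e * (edge_diff u e * edge_diff (response w) e)) =
    (\<Sum>e\<in>ordered_edges G. w e * edge_diff u e)"
proof -
  have row: "(\<Sum>b<n. Lz $$ (a, b) * response w b) =
      (\<Sum>e\<in>ordered_edges G. w e * edge_vec n (fst e) (snd e) $ a)" if a: "a < n" for a
  proof -
    have "(\<Sum>b<n. Lz $$ (a, b) * response w b) = (\<Sum>b<n. \<Sum>e\<in>ordered_edges G.
        w e * (Lz $$ (a, b) * Linv $$ (b, fst e) - Lz $$ (a, b) * Linv $$ (b, snd e)))"
      by (simp add: response_def sum_distrib_left algebra_simps)
    also have "\<dots> = (\<Sum>e\<in>ordered_edges G. \<Sum>b<n.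
        w e * (Lz $$ (a, b) * Linv $$ (b, fst e) - Lz $$ (a, b) * Linv $$ (b, snd e)))"
      by (rule sum.swap)
    also have "\<dots> = (\<Sum>e\<in>ordered_edges G. w e * edge_vec n (fst e) (snd e) $ a)"
    proof (intro sum.cong refl)
      fix e assume "e \<in> ordered_edges G"
      then have "fst e < n" "snd e < n"
        using parcs_less[of "fst e" "snd e"] ordered_edges_subset by auto
      then show "(\<Sum>b<n. w e * (Lz $$ (a, b) * Linv $$ (b, fst e) - Lz $$ (a, b) * Linv $$ (b, snd e)))
          = w e * edge_vec n (fst e) (snd e) $ a"
        using a by (simp add: sum_subtractf Lz_Linv_index edge_vec_index flip: sum_distrib_left)
    qed
    finally show ?thesis .
  qed
  have "(\<Sum>e\<in>ordered_edges G. edge_weight e * (edge_diff u e * edge_diff (response w) e)) =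
      (\<Sum>a<n. \<Sum>e\<in>ordered_edges G. u a * (w e * edge_vec n (fst e) (snd e) $ a))"
    unfolding Lz_energy[symmetric] by (simp add: row sum_distrib_left)
  also have "\<dots> = (\<Sum>e\<in>ordered_edges G. \<Sum>a<n. u a * (w e * edge_vec n (fst e) (snd e) $ a))"
    by (rule sum.swap)
  also have "\<dots> = (\<Sum>e\<in>ordered_edges G. w e * edge_diff u e)"
  proof (intro sum.cong refl)
    fix e assume "e \<in> ordered_edges G"
    then have "fst e < n" "snd e < n"
      using parcs_less[of "fst e" "snd e"] ordered_edges_subset by auto
    then have "w e * (\<Sum>a<n. u a * edge_vec n (fst e) (snd e) $ a) = w e * edge_diff u e"
      by (simp add: sum_edge_vec)
    then show "(\<Sum>a<n. u a * (w e * edge_vec n (fst e) (snd e) $ a)) = w e * edge_diff u e"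
      by (simp add: sum_distrib_left mult_ac)
  qed
  finally show ?thesis .
qed

text \<open>The row vector u = (e_k - e_l)^T \<open>Linv\<close> satisfies u^T \<open>Lz\<close> =
  (e_k - e_l)^T, so its energy is u_k - u_l, the effective resistance, while its edge differences
  are the values of \<open>pinv_form\<close>. The right-hand side later controls the squared
  coefficients in Hoeffding's inequality.\<close>

lemma eff_resistance_eq:
  assumes "k < n" "l < n"
  shows "eff_resistance n Lz k l =
    (\<Sum>e\<in>ordered_edges G. edge_weight e * (pinv_form n Lz (k, l) e)\<^sup>2)"
proof -
  define u where "u a = Linv $$ (k, a) - Linv $$ (l, a)" for a
  have "(\<Sum>e\<in>ordered_edges G. edge_weight e * (pinv_form n Lz (k, l) e)\<^sup>2) =
      (\<Sum>e\<in>ordered_edges G. edge_weight e * (edge_diff u e * edge_diff u e))"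
  proof (intro sum.cong refl)
    fix e assume "e \<in> ordered_edges G"
    then have "fst e < n" "snd e < n"
      using parcs_less[of "fst e" "snd e"] ordered_edges_subset by auto
    then have "pinv_form n Lz (k, l) e = edge_diff u e"
      using pinv_form_eq[of k l "fst e" "snd e"] assms by (simp add: u_def)
    then show "edge_weight e * (pinv_form n Lz (k, l) e)\<^sup>2 = edge_weight e * (edge_diff u e * edge_diff u e)"
      by (simp add: power2_eq_square)
  qed
  also have "\<dots> = (\<Sum>a<n. u a * (\<Sum>b<n. Lz $$ (a, b) * u b))"
    by (rule Lz_energy[symmetric])
  \<comment> \<open>The sums are regrouped so that \<open>Lz\<close> meets the left factor, where
    \<open>Linv * Lz\<close> is known; the two terms \<open>1 / n\<close> then cancel.\<close>
  also have "\<dots> = (\<Sum>a<n. \<Sum>b<n. u b * (u a * Lz $$ (a, b)))"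
    by (simp add: sum_distrib_left mult_ac)
  also have "\<dots> = (\<Sum>b<n. u b * (\<Sum>a<n. u a * Lz $$ (a, b)))"
    unfolding sum_distrib_left by (rule sum.swap)
  also have "\<dots> = (\<Sum>b<n. u b * edge_vec n k l $ b)"
    using assms by (intro sum.cong refl)
      (simp add: u_def left_diff_distrib sum_subtractf Linv_Lz_index edge_vec_index of_bool_def)
  also have "\<dots> = u k - u l" using assms by (rule sum_edge_vec)
  also have "\<dots> = eff_resistance n Lz k l"
    using assms by (simp add: eff_resistance_def pinv_form_eq u_def)
  finally show ?thesis by simp
qed

section \<open>Localising the maximum likelihood estimator\<close>

definition edge_loss :: "(nat \<times> nat \<times> nat \<Rightarrow> bool) \<Rightarrow> nat \<times> nat \<Rightarrow> real \<Rightarrow> real" where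
  "edge_loss y = (\<lambda>(i, j) x. \<Sum>l = 1..L i j. - of_bool (y (i, j, l)) * x + ln (1 + exp x))"

definition edge_score :: "(nat \<times> nat \<times> nat \<Rightarrow> bool) \<Rightarrow> nat \<times> nat \<Rightarrow> real \<Rightarrow> real" where
  "edge_score y = (\<lambda>(i, j) x. \<Sum>l = 1..L i j. sigmoid x - of_bool (y (i, j, l)))"

text \<open>With this sign it is the sum over the samples of outcome minus mean, hence
  centred.\<close>

definition noise :: "(nat \<times> nat \<times> nat \<Rightarrow> bool) \<Rightarrow> nat \<times> nat \<Rightarrow> real" where
  "noise y e = - edge_score y e (edge_diff (($) \<theta>s) e)"

definition nll :: "(nat \<times> nat \<times> nat \<Rightarrow> bool) \<Rightarrow> (nat \<Rightarrow> real) \<Rightarrow> real" where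
  "nll y u = (\<Sum>e\<in>ordered_edges G. edge_loss y e (edge_diff u e))"

lemma neg_log_lik_eq: "neg_log_lik G L y \<theta> = nll y (($) \<theta>)"
  by (simp add: neg_log_lik_def nll_def edge_loss_def case_prod_beta)

lemma DERIV_edge_loss: "(edge_loss y e has_real_derivative edge_score y e x) (at x)"
proof -
  have "((\<lambda>x. \<Sum>l = 1..L (fst e) (snd e). - of_bool (y (fst e, snd e, l)) * x + ln (1 + exp x))
    has_real_derivative (\<Sum>l = 1..L (fst e) (snd e). - of_bool (y (fst e, snd e, l)) + sigmoid x)) (at x)"
    by (intro DERIV_sum DERIV_add DERIV_softplus) (auto intro!: derivative_eq_intros)
  then show ?thesis by (simp add: edge_loss_def edge_score_def case_prod_beta)
qed

text \<open>Each sample contributes a strict tangent inequality, the outcome term being linear; the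
  sum stays strict because every edge carries at least one sample.\<close>

lemma edge_loss_above_tangent:
  assumes "e \<in> ordered_edges G" "b \<noteq> a"
  shows "edge_loss y e a + edge_score y e a * (b - a) < edge_loss y e b"
proof -
  obtain i j where e: "e = (i, j)" by (cases e)
  have ne: "{1..L i j} \<noteq> {}" using samples_pos[of i j] assms e by auto
  have "edge_loss y e a + edge_score y e a * (b - a) = (\<Sum>l = 1..L i j.
      (- of_bool (y (i, j, l)) * a + ln (1 + exp a)) + (sigmoid a - of_bool (y (i, j, l))) * (b - a))"
    by (simp add: e edge_loss_def edge_score_def sum_distrib_right sum.distrib)
  also have "\<dots> < (\<Sum>l = 1..L i j. - of_bool (y (i, j, l)) * b + ln (1 + exp b))"
    using softplus_above_tangent[OF assms(2)] ne
    by (intro sum_strict_mono) (auto simp: algebra_simps)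
  finally show ?thesis by (simp add: e edge_loss_def)
qed

text \<open>The stationarity equation for \<open>\<theta>s + D\<close>, linearised at \<open>\<theta>s\<close>, says that \<open>D\<close> solves the
  Laplace equation with right-hand side the divergence of \<open>residual_flow y D\<close>.\<close>

definition residual_flow :: "(nat \<times> nat \<times> nat \<Rightarrow> bool) \<Rightarrow> (nat \<Rightarrow> real) \<Rightarrow> nat \<times> nat \<Rightarrow> real" where
  "residual_flow y D e = edge_weight e * edge_diff D e -
     edge_score y e (edge_diff (($) \<theta>s) e + edge_diff D e)"

text \<open>The outcomes cancel in the difference, and \<open>edge_weight e\<close> is exactly the
  slope of the score at \<open>\<theta>s\<close>, so only the Taylor remainder of
  \<open>sigmoid\<close>, once per sample, survives.\<close>

lemma residual_flow_noise:
  "\<bar>residual_flow y D e - noise y e\<bar> \<le> real (L (fst e) (snd e)) * ((edge_diff D e)\<^sup>2 / 8)"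
proof -
  obtain i j where e: "e = (i, j)" by (cases e)
  define a d where "a = edge_diff (($) \<theta>s) e" and "d = edge_diff D e"
  have "residual_flow y D e - noise y e =
      - (real (L i j) * (sigmoid (a + d) - sigmoid a - deriv sigmoid a * d))"
    by (simp add: residual_flow_def noise_def edge_score_def edge_weight_def e a_def d_def
        sum_subtractf algebra_simps)
  then have "\<bar>residual_flow y D e - noise y e\<bar> =
      real (L i j) * \<bar>sigmoid (a + d) - sigmoid a - deriv sigmoid a * d\<bar>"
    by (simp add: abs_mult)
  also have "\<dots> \<le> real (L i j) * (d\<^sup>2 / 8)"
    by (intro mult_left_mono sigmoid_linearization) simp
  finally show ?thesis by (simp add: e d_def)
qed

text \<open>Split the flow into noise and Taylor remainder. The remainder on an edge is at most L
  b^2/8, and weighting it with the absolute value of \<open>pinv_form\<close> produces one eighth of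
  the sum bounded by \<open>q\<close>.\<close>

lemma response_residual_bound:
  assumes k: "k < n" "l < n"
    and D: "\<And>e. e \<in> ordered_edges G \<Longrightarrow> \<bar>edge_diff D e\<bar> \<le> b e"
    and Q: "(\<Sum>e\<in>ordered_edges G. real (L (fst e) (snd e)) * (b e)\<^sup>2 * \<bar>pinv_form n Lz (k, l) e\<bar>) \<le> q"
  shows "\<bar>response (residual_flow y D) k - response (residual_flow y D) l\<bar>
    \<le> \<bar>\<Sum>e\<in>ordered_edges G. noise y e * pinv_form n Lz (k, l) e\<bar> + q / 8"
proof -
  let ?p = "pinv_form n Lz (k, l)"
  have "\<bar>(\<Sum>e\<in>ordered_edges G. (residual_flow y D e - noise y e) * ?p e)\<bar> \<le>
      (\<Sum>e\<in>ordered_edges G. \<bar>(residual_flow y D e - noise y e) * ?p e\<bar>)"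
    by (rule sum_abs)
  also have "\<dots> \<le> (\<Sum>e\<in>ordered_edges G. real (L (fst e) (snd e)) * (b e)\<^sup>2 * \<bar>?p e\<bar> / 8)"
  proof (rule sum_mono)
    fix e assume e: "e \<in> ordered_edges G"
    have "(edge_diff D e)\<^sup>2 \<le> (b e)\<^sup>2"
      using D[OF e] by (metis abs_ge_zero power2_abs power_mono)
    then have "real (L (fst e) (snd e)) * ((edge_diff D e)\<^sup>2 / 8) \<le> real (L (fst e) (snd e)) * ((b e)\<^sup>2 / 8)"
      by (intro mult_left_mono) auto
    then have "\<bar>residual_flow y D e - noise y e\<bar> \<le> real (L (fst e) (snd e)) * ((b e)\<^sup>2 / 8)"
      using residual_flow_noise[of y D e] by linarith
    then have "\<bar>residual_flow y D e - noise y e\<bar> * \<bar>?p e\<bar> \<le> real (L (fst e) (snd e)) * ((b e)\<^sup>2 / 8) * \<bar>?p e\<bar>"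
      by (intro mult_right_mono) auto
    then show "\<bar>(residual_flow y D e - noise y e) * ?p e\<bar> \<le> real (L (fst e) (snd e)) * (b e)\<^sup>2 * \<bar>?p e\<bar> / 8"
      by (simp add: abs_mult)
  qed
  also have "\<dots> \<le> q / 8"
    using Q by (simp flip: sum_divide_distrib)
  finally have "\<bar>(\<Sum>e\<in>ordered_edges G. (residual_flow y D e - noise y e) * ?p e)\<bar> \<le> q / 8" .
  moreover have "response (residual_flow y D) k - response (residual_flow y D) l =
      (\<Sum>e\<in>ordered_edges G. noise y e * ?p e) +
      (\<Sum>e\<in>ordered_edges G. (residual_flow y D e - noise y e) * ?p e)"
    unfolding response_diff[OF k] sum.distrib[symmetric] by (simp add: algebra_simps)
  ultimately show ?thesis by linarith
qed

text \<open>The score is the linear term minus \<open>residual_flow\<close>, and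
  \<open>response_weak\<close> turns the pairing with the flow into an energy pairing. So the
  derivative of the likelihood along \<open>u\<close> is the energy pairing of \<open>u\<close> with
  the defect of the fixed point equation.\<close>

lemma sum_edge_score:
  "(\<Sum>e\<in>ordered_edges G. edge_score y e (edge_diff (($) \<theta>s) e + edge_diff D e) * edge_diff u e) =
    (\<Sum>e\<in>ordered_edges G. edge_weight e *
      (edge_diff u e * (edge_diff D e - edge_diff (response (residual_flow y D)) e)))"
proof -
  have "(\<Sum>e\<in>ordered_edges G. edge_score y e (edge_diff (($) \<theta>s) e + edge_diff D e) * edge_diff u e) =
      (\<Sum>e\<in>ordered_edges G. edge_weight e * (edge_diff u e * edge_diff D e)) -
      (\<Sum>e\<in>ordered_edges G. residual_flow y D e * edge_diff u e)"
    unfolding sum_subtractf[symmetric] by (simp add: residual_flow_def algebra_simps)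
  then show ?thesis
    unfolding response_weak[symmetric] sum_subtractf[symmetric] by (simp add: algebra_simps)
qed

text \<open>The displacement \<open>response (residual_flow y D) - D\<close> is the Newton direction with the Hessian
  frozen at \<open>\<theta>s\<close>, so its directional derivative is minus its own energy.\<close>

lemma constrained_min_imp_stationary:
  assumes min: "\<And>t. 0 \<le> t \<Longrightarrow> t \<le> 1 \<Longrightarrow>
      nll y (\<lambda>i. \<theta>s $ i + D i) \<le> nll y (\<lambda>i. \<theta>s $ i + (D i + t * (D' i - D i)))"
    and D': "\<And>e. e \<in> ordered_edges G \<Longrightarrow>
      edge_diff D' e = edge_diff (response (residual_flow y D)) e"
  shows "(\<Sum>e\<in>ordered_edges G. edge_score y e (edge_diff (($) \<theta>s) e + edge_diff D e) * edge_diff u e) = 0"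
proof -
  define R where "R = response (residual_flow y D)"
  define v where "v i = R i - D i" for i
  define f where "f t = nll y (\<lambda>i. \<theta>s $ i + (D i + t * (D' i - D i)))" for t
  define m where "m = (\<Sum>e\<in>ordered_edges G. edge_weight e * (edge_diff v e * edge_diff v e))"
  \<comment> \<open>\<open>D'\<close> agrees with the response only up to a constant, but the
    likelihood sees only differences along edges.\<close>
  have f: "f = (\<lambda>t. \<Sum>e\<in>ordered_edges G.
      edge_loss y e ((edge_diff (($) \<theta>s) e + edge_diff D e) + t * edge_diff v e))"
    unfolding f_def nll_def fun_eq_iff
  proof (intro allI sum.cong refl arg_cong[of _ _ "edge_loss _ _"])
    fix t e assume "e \<in> ordered_edges G"
    from D'[OF this] have "edge_diff D' e = edge_diff v e + edge_diff D e"
      by (simp add: v_def R_def)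
    then have "t * edge_diff D' e = t * (edge_diff v e + edge_diff D e)" by simp
    then show "\<theta>s $ fst e + (D (fst e) + t * (D' (fst e) - D (fst e))) -
        (\<theta>s $ snd e + (D (snd e) + t * (D' (snd e) - D (snd e)))) =
        edge_diff (($) \<theta>s) e + edge_diff D e + t * edge_diff v e"
      by (simp add: algebra_simps)
  qed
  have "(f has_real_derivative (\<Sum>e\<in>ordered_edges G.
      edge_score y e (edge_diff (($) \<theta>s) e + edge_diff D e) * edge_diff v e)) (at 0)"
    unfolding f
    by (intro DERIV_sum DERIV_chain2[OF DERIV_edge_loss[THEN DERIV_cong]])
      (auto intro!: derivative_eq_intros)
  moreover have "(\<Sum>e\<in>ordered_edges G.
      edge_score y e (edge_diff (($) \<theta>s) e + edge_diff D e) * edge_diff v e) = - m"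
    unfolding sum_edge_score m_def sum_negf[symmetric]
    by (intro sum.cong refl) (simp add: v_def R_def algebra_simps)
  ultimately have der: "(f has_real_derivative - m) (at 0)" by simp
  have "m \<le> 0"
  proof (rule ccontr)
    assume "\<not> m \<le> 0"
    then obtain d where d: "d > 0" and dec: "\<And>h. 0 < h \<Longrightarrow> h < d \<Longrightarrow> f (0 + h) < f 0"
      using DERIV_neg_dec_right[OF der] by auto
    \<comment> \<open>A step small enough for the strict decrease and at most 1, so that the
      minimality assumption still covers it.\<close>
    define h where "h = min 1 (d / 2)"
    have "0 < h" "h < d" "h \<le> 1" using d by (auto simp: h_def)
    with dec[of h] min[of h] show False by (simp add: f_def)
  qed
  then have v: "edge_diff v e = 0" if "e \<in> ordered_edges G" for e
    using that unfolding m_def by (rule energy_zero_imp_edge_diff_zero)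
  show ?thesis
    unfolding sum_edge_score
  proof (intro sum.neutral ballI)
    fix e assume "e \<in> ordered_edges G"
    from v[OF this] have "edge_diff D e - edge_diff (response (residual_flow y D)) e = 0"
      by (simp add: v_def R_def)
    then show "edge_weight e * (edge_diff u e *
        (edge_diff D e - edge_diff (response (residual_flow y D)) e)) = 0"
      by (simp only: mult_zero_right)
  qed
qed

text \<open>Sum the tangent inequalities of the edge losses: the linear terms cancel by stationarity
  tested with \<open>w - v\<close>, and the given edge makes the inequality strict.\<close>

lemma nll_above_stationary:
  assumes stat: "\<And>u. (\<Sum>e\<in>ordered_edges G. edge_score y e (edge_diff v e) * edge_diff u e) = 0"
    and "e \<in> ordered_edges G" "edge_diff w e \<noteq> edge_diff v e"
  shows "nll y v < nll y w"
proof -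
  have "(\<Sum>e\<in>ordered_edges G. edge_loss y e (edge_diff v e) +
      edge_score y e (edge_diff v e) * (edge_diff w e - edge_diff v e)) < nll y w"
    unfolding nll_def
  proof (rule sum_strict_mono_ex1[OF finite_ordered_edges])
    show "\<forall>e\<in>ordered_edges G. edge_loss y e (edge_diff v e) +
        edge_score y e (edge_diff v e) * (edge_diff w e - edge_diff v e) \<le> edge_loss y e (edge_diff w e)"
    proof
      fix e assume "e \<in> ordered_edges G"
      from edge_loss_above_tangent[OF this]
      show "edge_loss y e (edge_diff v e) +
        edge_score y e (edge_diff v e) * (edge_diff w e - edge_diff v e) \<le> edge_loss y e (edge_diff w e)"
        by (cases "edge_diff w e = edge_diff v e") (auto simp: less_imp_le)
    qed
    show "\<exists>e\<in>ordered_edges G. edge_loss y e (edge_diff v e) +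
        edge_score y e (edge_diff v e) * (edge_diff w e - edge_diff v e) < edge_loss y e (edge_diff w e)"
      using edge_loss_above_tangent assms by blast
  qed
  moreover have "(\<Sum>e\<in>ordered_edges G. edge_loss y e (edge_diff v e) +
      edge_score y e (edge_diff v e) * (edge_diff w e - edge_diff v e)) =
      nll y v + (\<Sum>e\<in>ordered_edges G. edge_score y e (edge_diff v e) * edge_diff (\<lambda>i. w i - v i) e)"
    unfolding nll_def sum.distrib[symmetric] by (intro sum.cong refl) (simp add: algebra_simps)
  ultimately show ?thesis using stat[of "\<lambda>i. w i - v i"] by linarith
qed

text \<open>Pinning the value at node 0 removes the freedom of adding constants, and the coordinates
  from \<open>n\<close> on are set to 0. What remains is a closed subset of a product of compact
  intervals, so Tychonoff applies.\<close>

lemma compact_difference_box: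
  "compact {D :: nat \<Rightarrow> real. D 0 = 0 \<and> (\<forall>i\<ge>n. D i = 0) \<and> (\<forall>k l. k < l \<and> l < n \<longrightarrow> \<bar>D k - D l\<bar> \<le> \<beta> k l)}"
    (is "compact ?K")
proof -
  \<comment> \<open>Since \<open>D 0 = 0\<close>, the constraint on the pair of nodes 0 and
    \<open>i\<close> already bounds the coordinate \<open>i\<close>.\<close>
  define M where "M i = (if 0 < i \<and> i < n then \<beta> 0 i else 0)" for i
  have box: "compact (PiE UNIV (\<lambda>i. {- M i..M i}))"
    using compactin_PiE[of "\<lambda>_ :: nat. euclidean" UNIV "\<lambda>i. {- M i..M i}"]
    by (simp add: euclidean_product_topology)
  have closed: "closed ?K"
    by (intro closed_Collect_conj closed_Collect_all closed_Collect_imp open_Collect_const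
        closed_Collect_le closed_Collect_eq continuous_intros continuous_on_product_coordinates)
  have "?K \<subseteq> PiE UNIV (\<lambda>i. {- M i..M i})"
  proof
    fix D assume D: "D \<in> ?K"
    have "D i \<in> {- M i..M i}" for i
    proof (cases "0 < i \<and> i < n")
      case True
      then have "\<bar>D 0 - D i\<bar> \<le> \<beta> 0 i" using D by blast
      then show ?thesis using D True by (auto simp: M_def)
    next
      case False
      then have "i = 0 \<or> i \<ge> n" by auto
      then show ?thesis using D False by (auto simp: M_def)
    qed
    then show "D \<in> PiE UNIV (\<lambda>i. {- M i..M i})" by auto
  qed
  then show ?thesis using closed_Int_compact[OF closed box] by (simp only: Int_absorb2)
qed

lemma continuous_nll: "continuous_on S (\<lambda>D. nll y (\<lambda>i. \<theta>s $ i + D i))"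
proof -
  have "continuous_on UNIV (edge_loss y e)" for e
    by (intro DERIV_continuous_on[of _ _ "edge_score y e"]) (rule DERIV_edge_loss)
  then have "continuous_on S (\<lambda>D. edge_loss y e (edge_diff (\<lambda>i. \<theta>s $ i + D i) e))" for e
    by (rule continuous_on_compose2)
      (auto intro!: continuous_intros continuous_on_subset[OF continuous_on_product_coordinates])
  then show ?thesis unfolding nll_def by (intro continuous_on_sum)
qed

text \<open>The deterministic half of the argument: every outcome \<open>y\<close> whose noise meets
  the first hypothesis has the desired estimator, so only the probability of that event remains to
  be bounded.\<close>

theorem mle_localization:
  assumes B: "\<And>k l. k < l \<Longrightarrow> l < n \<Longrightarrow>
      \<bar>\<Sum>e\<in>ordered_edges G. noise y e * pinv_form n Lz (k, l) e\<bar> \<le> B k l / 2"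
    and Q: "\<And>k l. k < l \<Longrightarrow> l < n \<Longrightarrow>
      (\<Sum>e\<in>ordered_edges G. real (L (fst e) (snd e)) * (B (fst e) (snd e))\<^sup>2 * \<bar>pinv_form n Lz (k, l) e\<bar>) \<le> Q k l"
    and QB: "\<And>k l. (k, l) \<in> ordered_edges G \<Longrightarrow> Q k l \<le> 4 * B k l"
  shows "\<exists>!\<theta>. is_mle n G L y \<theta>"
    and "is_mle n G L y \<theta> \<Longrightarrow> k < l \<Longrightarrow> l < n \<Longrightarrow>
      \<bar>(\<theta> $ k - \<theta> $ l) - (\<theta>s $ k - \<theta>s $ l)\<bar> \<le> B k l / 2 + Q k l / 8"
proof -
  define \<beta> where "\<beta> k l = B k l / 2 + Q k l / 8" for k l
  define K where "K = {D :: nat \<Rightarrow> real. D 0 = 0 \<and> (\<forall>i\<ge>n. D i = 0) \<and>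
    (\<forall>k l. k < l \<and> l < n \<longrightarrow> \<bar>D k - D l\<bar> \<le> \<beta> k l)}"
  \<comment> \<open>Subtracting the value at node 0 restores the normalisation of \<open>K\<close>
    without changing differences.\<close>
  define \<Phi> where "\<Phi> D i = (if i < n then response (residual_flow y D) i - response (residual_flow y D) 0 else 0)" for D i
  have edge: "k < l" "l < n" if "(k, l) \<in> ordered_edges G" for k l
    using that parcs_less[of k l] by (auto simp: ordered_edges_def)
  have \<beta>_edge: "\<beta> k l \<le> B k l" if "(k, l) \<in> ordered_edges G" for k l
    using QB[OF that] by (simp add: \<beta>_def)
  \<comment> \<open>Both bounds dominate nonnegative quantities, so the radii are nonnegative and
    \<open>K\<close> contains 0.\<close>
  have Q_nonneg: "0 \<le> Q k l" if "k < l" "l < n" for k l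
    by (rule order_trans[OF sum_nonneg Q[OF that]]) simp
  have \<beta>_nonneg: "0 \<le> \<beta> k l" if "k < l" "l < n" for k l
    using Q_nonneg[OF that] order_trans[OF abs_ge_zero B[OF that]] by (simp add: \<beta>_def)
  \<comment> \<open>On edges the radius is at most \<open>B\<close>, so the remainder estimate
    applies with \<open>b\<close> equal to \<open>B\<close> and returns precisely the radius
    \<open>B k l / 2 + Q k l / 8\<close> for every pair.\<close>
  have \<Phi>_K: "\<Phi> D \<in> K" if D: "D \<in> K" for D
  proof -
    have "\<bar>edge_diff D e\<bar> \<le> B (fst e) (snd e)" if e: "e \<in> ordered_edges G" for e
    proof -
      have "\<bar>edge_diff D e\<bar> \<le> \<beta> (fst e) (snd e)"
        using D edge[of "fst e" "snd e"] e by (auto simp: K_def)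
      then show ?thesis using \<beta>_edge[of "fst e" "snd e"] e by simp
    qed
    note bound = response_residual_bound[of _ _ D "\<lambda>e. B (fst e) (snd e)", OF _ _ this]
    have "\<bar>\<Phi> D k - \<Phi> D l\<bar> \<le> \<beta> k l" if kl: "k < l" "l < n" for k l
      using bound[of k l "Q k l" y] Q[OF kl] B[OF kl] kl by (simp add: \<Phi>_def \<beta>_def)
    then show ?thesis using n_pos by (auto simp: K_def \<Phi>_def)
  qed
  have "(\<lambda>_. 0) \<in> K" using \<beta>_nonneg by (auto simp: K_def)
  then obtain D where D: "D \<in> K"
    and D_min: "\<And>D'. D' \<in> K \<Longrightarrow> nll y (\<lambda>i. \<theta>s $ i + D i) \<le> nll y (\<lambda>i. \<theta>s $ i + D' i)"
    using continuous_attains_inf[OF compact_difference_box[of \<beta>, folded K_def] _ continuous_nll[of K y]]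
    by blast
  have segment: "(\<lambda>i. D i + t * (\<Phi> D i - D i)) \<in> K" if t: "0 \<le> t" "t \<le> 1" for t
  proof -
    have "\<bar>D k + t * (\<Phi> D k - D k) - (D l + t * (\<Phi> D l - D l))\<bar> \<le> \<beta> k l" if kl: "k < l" "l < n" for k l
    proof -
      have "\<bar>D k + t * (\<Phi> D k - D k) - (D l + t * (\<Phi> D l - D l))\<bar> =
          \<bar>(1 - t) * (D k - D l) + t * (\<Phi> D k - \<Phi> D l)\<bar>"
        by (simp add: algebra_simps)
      also have "\<dots> \<le> (1 - t) * \<bar>D k - D l\<bar> + t * \<bar>\<Phi> D k - \<Phi> D l\<bar>"
        using t by (intro order_trans[OF abs_triangle_ineq]) (simp add: abs_mult)
      also have "\<dots> \<le> (1 - t) * \<beta> k l + t * \<beta> k l"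
        using t D \<Phi>_K[OF D] kl by (intro add_mono mult_left_mono) (auto simp: K_def)
      finally show ?thesis by (simp add: algebra_simps)
    qed
    moreover have "D i + t * (\<Phi> D i - D i) = 0" if "i = 0 \<or> i \<ge> n" for i
    proof -
      have "D i = 0" "\<Phi> D i = 0" using D \<Phi>_K[OF D] that by (auto simp: K_def)
      then show ?thesis by simp
    qed
    ultimately show ?thesis by (simp add: K_def)
  qed
  define v where "v i = \<theta>s $ i + D i" for i
  have stat: "(\<Sum>e\<in>ordered_edges G. edge_score y e (edge_diff v e) * edge_diff u e) = 0" for u
  proof -
    have "edge_diff (\<Phi> D) e = edge_diff (response (residual_flow y D)) e" if "e \<in> ordered_edges G" for e
      using edge[of "fst e" "snd e"] that by (auto simp: \<Phi>_def)
    from constrained_min_imp_stationary[OF D_min[OF segment] this, of u]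
    show ?thesis by (simp add: v_def algebra_simps)
  qed
  \<comment> \<open>The stationary point is centred to satisfy the constraint on the sum; this
    leaves all differences, and so the likelihood, unchanged.\<close>
  define c where "c = (\<Sum>i<n. v i) / n"
  define \<theta>h where "\<theta>h = vec n (\<lambda>i. v i - c)"
  have \<theta>h: "\<theta>h \<in> carrier_vec n" "(\<Sum>i<n. \<theta>h $ i) = 0"
    using n_pos by (simp_all add: \<theta>h_def sum_subtractf c_def)
  have edge_\<theta>h: "edge_diff (($) \<theta>h) e = edge_diff v e" if "e \<in> ordered_edges G" for e
    using edge[of "fst e" "snd e"] that by (simp add: \<theta>h_def)
  have nll_\<theta>h: "nll y (($) \<theta>h) = nll y v"
    unfolding nll_def using edge_\<theta>h by (intro sum.cong) auto
  have \<theta>h_le: "nll y v \<le> nll y w" for w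
  proof (cases "\<forall>e\<in>ordered_edges G. edge_diff w e = edge_diff v e")
    case True
    then have "nll y w = nll y v" unfolding nll_def by (intro sum.cong) auto
    then show ?thesis by simp
  next
    case False
    then show ?thesis using nll_above_stationary[OF stat] less_imp_le by blast
  qed
  have mle: "is_mle n G L y \<theta>h"
    using \<theta>h \<theta>h_le by (auto simp: is_mle_def is_arg_min_def neg_log_lik_eq nll_\<theta>h not_less)
  \<comment> \<open>By strictness another minimiser has the same edge differences, hence differs
    from \<open>\<theta>h\<close> by a constant on the nodes; both have sum 0, so this constant is
    0.\<close>
  have unique: "\<theta> = \<theta>h" if "is_mle n G L y \<theta>" for \<theta>
  proof -
    have \<theta>: "\<theta> \<in> carrier_vec n" "(\<Sum>i<n. \<theta> $ i) = 0" and "nll y (($) \<theta>) \<le> nll y v"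
      using that \<theta>h by (auto simp: is_mle_def is_arg_min_def neg_log_lik_eq not_less simp flip: nll_\<theta>h)
    then have eq: "edge_diff (($) \<theta>) e = edge_diff v e" if "e \<in> ordered_edges G" for e
      using nll_above_stationary[OF stat that] by (meson not_le)
    have const: "\<theta> $ i - \<theta>h $ i = \<theta> $ 0 - \<theta>h $ 0" if "i < n" for i
    proof (rule const_if_const_on_edges[of "\<lambda>i. \<theta> $ i - \<theta>h $ i"])
      show "\<theta> $ i - \<theta>h $ i = \<theta> $ j - \<theta>h $ j" if "(i, j) \<in> ordered_edges G" for i j
        using eq[OF that] edge_\<theta>h[OF that] by simp
    qed (use that n_pos in auto)
    have "(\<Sum>i<n. \<theta> $ i - \<theta>h $ i) = (\<Sum>i<n. \<theta> $ 0 - \<theta>h $ 0)"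
      by (intro sum.cong refl const) simp
    then have "\<theta> $ 0 - \<theta>h $ 0 = 0" using \<theta> \<theta>h n_pos by (simp add: sum_subtractf)
    then have "\<theta> $ i = \<theta>h $ i" if "i < n" for i using const[OF that] by simp
    then show ?thesis using \<theta>(1) \<theta>h(1) by (intro eq_vecI) auto
  qed
  show "\<exists>!\<theta>. is_mle n G L y \<theta>" using mle unique by blast
  show "\<bar>(\<theta> $ k - \<theta> $ l) - (\<theta>s $ k - \<theta>s $ l)\<bar> \<le> B k l / 2 + Q k l / 8"
    if "is_mle n G L y \<theta>" "k < l" "l < n"
  proof -
    have "\<bar>D k - D l\<bar> \<le> B k l / 2 + Q k l / 8" using D that by (simp add: K_def \<beta>_def)
    then show ?thesis using unique[OF that(1)] that by (simp add: \<theta>h_def v_def)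
  qed
qed

end

section \<open>Concentration of the noise\<close>

text \<open>Hoeffding's two-sided inequality for the independent variables
  \<open>a i * of_bool (y i)\<close>, each confined to an interval of length |a_i|.\<close>

lemma Pi_pmf_bernoulli_deviation:
  fixes a p :: "'a \<Rightarrow> real"
  assumes fin: "finite I" and p: "\<And>i. i \<in> I \<Longrightarrow> 0 \<le> p i \<and> p i \<le> 1"
    and pos: "0 < (\<Sum>i\<in>I. (a i)\<^sup>2)" and "0 \<le> t"
  shows "measure_pmf.prob (Pi_pmf I d (\<lambda>i. bernoulli_pmf (p i)))
      {y. t \<le> \<bar>\<Sum>i\<in>I. a i * (of_bool (y i) - p i)\<bar>} \<le> 2 * exp (- 2 * t\<^sup>2 / (\<Sum>i\<in>I. (a i)\<^sup>2))"
proof -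
  define M where "M = Pi_pmf I d (\<lambda>i. bernoulli_pmf (p i))"
  define X where "X = (\<lambda>i y. a i * of_bool (y i) :: real)"
  \<comment> \<open>The coefficient \<open>a i\<close> may have either sign, so the endpoints 0 and
    \<open>a i\<close> must be put in order.\<close>
  define lo hi where "lo i = min 0 (a i)" and "hi i = max 0 (a i)" for i
  have EX: "measure_pmf.expectation M (X i) = a i * p i" if "i \<in> I" for i
  proof -
    have "measure_pmf.expectation M (X i) =
        measure_pmf.expectation (map_pmf (\<lambda>y. y i) M) (\<lambda>b. a i * of_bool b)"
      by (simp add: X_def)
    also have "map_pmf (\<lambda>y. y i) M = bernoulli_pmf (p i)"
      using that fin by (simp add: M_def Pi_pmf_component)
    finally show ?thesis using p[OF that] by simp
  qed
  interpret Hoeffding_ineq M I X lo hi "\<Sum>i\<in>I. measure_pmf.expectation M (X i)"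
  proof unfold_locales
    show "prob_space.indep_vars M (\<lambda>_. borel) X I"
      unfolding X_def M_def
      by (intro prob_space.indep_vars_compose2[OF _ indep_vars_Pi_pmf[OF fin]])
        (auto simp: measure_pmf.prob_space_axioms)
  qed (auto simp: fin X_def lo_def hi_def of_bool_def)
  have "(\<Sum>i\<in>I. (hi i - lo i)\<^sup>2) = (\<Sum>i\<in>I. (a i)\<^sup>2)"
    by (intro sum.cong refl) (auto simp: lo_def hi_def min_def max_def)
  moreover have "(\<Sum>i\<in>I. X i y) - (\<Sum>i\<in>I. measure_pmf.expectation M (X i)) =
      (\<Sum>i\<in>I. a i * (of_bool (y i) - p i))" for y
    unfolding sum_subtractf[symmetric] by (intro sum.cong refl) (simp add: EX, simp add: X_def algebra_simps)
  ultimately show ?thesis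
    using Hoeffding_ineq_abs_ge[OF \<open>0 \<le> t\<close>] pos by (simp add: M_def)
qed

context btl_model
begin

lemma sum_sample_index:
  "(\<Sum>(i, j, l)\<in>sample_index G L. f i j l) = (\<Sum>(i, j)\<in>ordered_edges G. \<Sum>l = 1..L i j. f i j l)"
proof -
  have "(\<Sum>(i, j, l)\<in>sample_index G L. f i j l) =
      (\<Sum>(e, l)\<in>(SIGMA e : ordered_edges G. {1..L (fst e) (snd e)}). f (fst e) (snd e) l)"
    by (rule sum.reindex_bij_witness[of _ "\<lambda>(e, l). (fst e, snd e, l)" "\<lambda>(i, j, l). ((i, j), l)"])
      (auto simp: sample_index_def)
  also have "\<dots> = (\<Sum>e\<in>ordered_edges G. \<Sum>l = 1..L (fst e) (snd e). f (fst e) (snd e) l)"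
    using finite_ordered_edges by (subst sum.Sigma) auto
  finally show ?thesis by (simp add: case_prod_beta)
qed

lemma finite_sample_index: "finite (sample_index G L)"
proof -
  have "sample_index G L \<subseteq> (\<lambda>((i, j), l). (i, j, l)) ` (SIGMA e : ordered_edges G. {1..L (fst e) (snd e)})"
    by (force simp: sample_index_def)
  then show ?thesis
    by (rule finite_subset) (intro finite_imageI finite_SigmaI finite_ordered_edges finite_atLeastAtMost)
qed

lemma edge_weight_lower_bound:
  assumes "e \<in> ordered_edges G"
  shows "real (L (fst e) (snd e)) \<le> 4 * \<kappa> * edge_weight e"
proof -
  have "(fst e, snd e) \<in> parcs G" using assms ordered_edges_subset by auto
  from deriv_sigmoid_lower_bound[OF kappa_bound[OF this] kappa_ge_1] kappa_ge_1
  have "1 \<le> 4 * \<kappa> * deriv sigmoid (\<theta>s $ fst e - \<theta>s $ snd e)"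
    by (simp add: field_simps)
  then have "real (L (fst e) (snd e)) * 1 \<le>
      real (L (fst e) (snd e)) * (4 * \<kappa> * deriv sigmoid (\<theta>s $ fst e - \<theta>s $ snd e))"
    by (intro mult_left_mono) auto
  then show ?thesis by (simp add: edge_weight_def case_prod_beta mult_ac)
qed

lemma eff_resistance_nonneg:
  "k < n \<Longrightarrow> l < n \<Longrightarrow> 0 \<le> eff_resistance n Lz k l"
  using edge_weight_pos by (auto simp: eff_resistance_eq less_imp_le intro!: sum_nonneg mult_nonneg_nonneg)

text \<open>The sum is linear in the centred samples, with \<open>pinv_form\<close> as coefficients.
  By the lower bound on the weights its sum of squared coefficients V is at most 4\<kappa> times the
  effective resistance, so t^2 \<ge> V s and Hoeffding's exponent is at most -2s.\<close>

lemma noise_deviation: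
  assumes k: "k < n" "l < n" and "0 \<le> s"
    and t: "2 * sqrt (eff_resistance n Lz k l * \<kappa> * s) \<le> t"
  shows "measure_pmf.prob (btl_samples G L \<theta>s)
    {y. t < \<bar>\<Sum>e\<in>ordered_edges G. noise y e * pinv_form n Lz (k, l) e\<bar>} \<le> 2 * exp (- 2 * s)"
proof -
  let ?R = "eff_resistance n Lz k l"
  define a :: "nat \<times> nat \<times> nat \<Rightarrow> real" where "a = (\<lambda>(i, j, m). pinv_form n Lz (k, l) (i, j))"
  define p :: "nat \<times> nat \<times> nat \<Rightarrow> real" where "p = (\<lambda>(i, j, m). sigmoid (\<theta>s $ i - \<theta>s $ j))"
  define V where "V = (\<Sum>i\<in>sample_index G L. (a i)\<^sup>2)"
  have sum_eq: "(\<Sum>e\<in>ordered_edges G. noise y e * pinv_form n Lz (k, l) e) =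
      (\<Sum>i\<in>sample_index G L. a i * (of_bool (y i) - p i))" for y
  proof -
    have "(\<Sum>i\<in>sample_index G L. a i * (of_bool (y i) - p i)) =
        (\<Sum>(i, j, m)\<in>sample_index G L. pinv_form n Lz (k, l) (i, j) *
          (of_bool (y (i, j, m)) - sigmoid (\<theta>s $ i - \<theta>s $ j)))"
      by (simp add: a_def p_def case_prod_beta)
    also have "\<dots> = (\<Sum>e\<in>ordered_edges G. noise y e * pinv_form n Lz (k, l) e)"
      unfolding sum_sample_index
      by (intro sum.cong refl)
        (simp add: case_prod_beta noise_def edge_score_def mult.commute
          flip: sum_distrib_left sum_negf)
    finally show ?thesis by simp
  qed
  have "V = (\<Sum>(i, j, m)\<in>sample_index G L. (pinv_form n Lz (k, l) (i, j))\<^sup>2)"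
    by (simp add: V_def a_def case_prod_beta)
  also have "\<dots> = (\<Sum>e\<in>ordered_edges G. real (L (fst e) (snd e)) * (pinv_form n Lz (k, l) e)\<^sup>2)"
    unfolding sum_sample_index by (simp add: case_prod_beta)
  also have "\<dots> \<le> (\<Sum>e\<in>ordered_edges G. 4 * \<kappa> * edge_weight e * (pinv_form n Lz (k, l) e)\<^sup>2)"
    by (intro sum_mono mult_right_mono edge_weight_lower_bound) auto
  also have "\<dots> = 4 * \<kappa> * ?R"
    by (simp add: eff_resistance_eq[OF k] sum_distrib_left mult_ac)
  finally have V: "V \<le> 4 * \<kappa> * ?R" .
  have R: "0 \<le> ?R * \<kappa> * s" using eff_resistance_nonneg[OF k] kappa_ge_1 \<open>0 \<le> s\<close> by simp
  then have "0 \<le> t" using t order_trans[of 0 "2 * sqrt (?R * \<kappa> * s)" t] by simp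
  have "0 \<le> V" by (simp add: V_def sum_nonneg)
  \<comment> \<open>If V = 0 every coefficient vanishes and so does the noise sum; the event is then
    empty because its inequality is strict, even for \<open>t = 0\<close>.\<close>
  then consider "V = 0" | "0 < V" by linarith
  then show ?thesis
  proof cases
    case 1
    then have "a i = 0" if "i \<in> sample_index G L" for i
      using that finite_sample_index by (simp add: V_def sum_nonneg_eq_0_iff)
    then have "(\<Sum>i\<in>sample_index G L. a i * (of_bool (y i) - p i)) = 0" for y
      by (intro sum.neutral) simp
    then show ?thesis using \<open>0 \<le> t\<close> by (simp add: sum_eq)
  next
    case 2
    have "measure_pmf.prob (btl_samples G L \<theta>s)
        {y. t < \<bar>\<Sum>i\<in>sample_index G L. a i * (of_bool (y i) - p i)\<bar>} \<le>
      measure_pmf.prob (btl_samples G L \<theta>s)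
        {y. t \<le> \<bar>\<Sum>i\<in>sample_index G L. a i * (of_bool (y i) - p i)\<bar>}"
      by (intro measure_pmf.finite_measure_mono) auto
    also have "\<dots> \<le> 2 * exp (- 2 * t\<^sup>2 / V)"
    proof -
      have "btl_samples G L \<theta>s = Pi_pmf (sample_index G L) False (\<lambda>i. bernoulli_pmf (p i))"
        by (simp add: btl_samples_def p_def case_prod_unfold)
      moreover have "0 \<le> p i \<and> p i \<le> 1" for i
        using sigmoid_bounds by (simp add: p_def case_prod_beta less_imp_le)
      ultimately show ?thesis
        using Pi_pmf_bernoulli_deviation[OF finite_sample_index, of p a t False] 2 \<open>0 \<le> t\<close>
        by (simp add: V_def)
    qed
    also have "2 * exp (- 2 * t\<^sup>2 / V) \<le> 2 * exp (- 2 * s)"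
    proof -
      have "(2 * sqrt (?R * \<kappa> * s))\<^sup>2 \<le> t\<^sup>2" using t R by (intro power_mono) auto
      then have "4 * \<kappa> * ?R * s \<le> t\<^sup>2" using R by (simp add: power_mult_distrib mult_ac)
      moreover have "V * s \<le> 4 * \<kappa> * ?R * s" using V \<open>0 \<le> s\<close> by (rule mult_right_mono)
      ultimately have "s \<le> t\<^sup>2 / V" using 2 by (simp add: field_simps)
      then show ?thesis by simp
    qed
    finally show ?thesis by (simp add: sum_eq)
  qed
qed

text \<open>Union bound over at most n^2 pairs, using the single-pair estimate with s =
  ln(n/\<delta>) and threshold \<open>B k l / 2\<close>. Each pair fails with probability at most
  2(\<delta>/n)^2.\<close>

lemma noise_uniform_deviation:
  assumes \<delta>: "0 < \<delta>" "\<delta> < 1 / 2"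
    and B: "\<And>k l. k < l \<Longrightarrow> l < n \<Longrightarrow>
      4 * sqrt (eff_resistance n Lz k l * \<kappa> * ln (real n / \<delta>)) \<le> B k l"
  shows "measure_pmf.prob (btl_samples G L \<theta>s)
    {y. \<forall>k l. k < l \<and> l < n \<longrightarrow>
      \<bar>\<Sum>e\<in>ordered_edges G. noise y e * pinv_form n Lz (k, l) e\<bar> \<le> B k l / 2} \<ge> 1 - \<delta>"
    (is "measure_pmf.prob ?M ?good \<ge> _")
proof -
  define bad where "bad = (\<lambda>(k, l). {y. B k l / 2 <
    \<bar>\<Sum>e\<in>ordered_edges G. noise y e * pinv_form n Lz (k, l) e\<bar>})"
  define P where "P = {(k, l). k < l \<and> l < n}"
  have P: "P \<subseteq> {..<n} \<times> {..<n}" by (auto simp: P_def)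
  then have fin: "finite P" by (rule finite_subset) simp
  have "card P \<le> n * n" using card_mono[OF _ P] by simp
  have n1: "1 \<le> real n" using n_pos by simp
  then have "1 \<le> real n / \<delta>" using \<delta> by (simp add: field_simps)
  then have ln: "0 \<le> ln (real n / \<delta>)" by simp
  have "exp (- 2 * ln (real n / \<delta>)) = (\<delta> / real n)\<^sup>2"
  proof -
    have "exp (- 2 * ln (real n / \<delta>)) = inverse (exp (ln (real n / \<delta>)))^2"
      by (simp add: exp_minus exp_double power_inverse)
    then show ?thesis using \<delta> n_pos by simp
  qed
  moreover have "measure_pmf.prob ?M (bad kl) \<le> 2 * exp (- 2 * ln (real n / \<delta>))" if "kl \<in> P" for kl
    using that B[of "fst kl" "snd kl"] noise_deviation[OF _ _ ln, of "fst kl" "snd kl" "B (fst kl) (snd kl) / 2"]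
    by (auto simp: P_def bad_def)
  ultimately have single: "measure_pmf.prob ?M (bad kl) \<le> 2 * (\<delta> / real n)\<^sup>2" if "kl \<in> P" for kl
    using that by metis
  have "y \<in> bad (k, l) \<longleftrightarrow> \<not> \<bar>\<Sum>e\<in>ordered_edges G. noise y e * pinv_form n Lz (k, l) e\<bar> \<le> B k l / 2"
    for y k l by (simp add: bad_def not_le)
  then have "- ?good = (\<Union>kl\<in>P. bad kl)" unfolding P_def by blast
  then have "measure_pmf.prob ?M (- ?good) \<le> (\<Sum>kl\<in>P. measure_pmf.prob ?M (bad kl))"
    using measure_UNION_le[OF fin, of bad ?M] by simp
  also have "\<dots> \<le> real (card P) * (2 * (\<delta> / real n)\<^sup>2)"
    using single by (intro sum_bounded_above[of P, simplified]) auto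
  also have "\<dots> \<le> real (n * n) * (2 * (\<delta> / real n)\<^sup>2)"
    using \<open>card P \<le> n * n\<close> by (intro mult_right_mono of_nat_mono) auto
  also have "\<dots> = 2 * \<delta> * \<delta>" using n_pos by (simp add: power2_eq_square)
  \<comment> \<open>The assumption \<delta> < 1/2 absorbs the factor 2 of the two-sided
    tail.\<close>
  also have "\<dots> \<le> 1 * \<delta>" using \<delta> by (intro mult_right_mono) auto
  finally show ?thesis
    using measure_pmf.prob_compl[of ?good ?M] by (simp add: Compl_eq_Diff_UNIV)
qed

end

section \<open>Combining concentration with localisation\<close>

theorem theorem1:
  shows "\<exists>C0 > 0. \<forall>n G L \<theta>s \<kappa> (\<delta> :: real) (B :: nat \<Rightarrow> nat \<Rightarrow> real) (Q :: nat \<Rightarrow> nat \<Rightarrow> real).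
    btl_model n G L \<theta>s \<kappa> \<longrightarrow> 0 < \<delta> \<longrightarrow> \<delta> < 1 / 2 \<longrightarrow>
    (\<forall>k<n. \<forall>l<n. B k l = B l k \<and> Q k l = Q l k) \<longrightarrow>
    (\<forall>k<n. \<forall>l<n. k \<noteq> l \<longrightarrow>
       B k l \<ge> C0 * sqrt (eff_resistance n (laplacian n G L \<theta>s) k l * \<kappa> * ln (real n / \<delta>)) \<and>
       Q k l \<ge> (\<Sum>(i, j)\<in>ordered_edges G.
         real (L i j) * (B i j)\<^sup>2 * \<bar>pinv_form n (laplacian n G L \<theta>s) (k, l) (i, j)\<bar>)) \<longrightarrow>
    (\<forall>(k, l)\<in>parcs G. Q k l \<le> 4 * B k l) \<longrightarrow>
    measure_pmf.prob (btl_samples G L \<theta>s)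
      {y. (\<exists>!\<theta>. is_mle n G L y \<theta>) \<and>
          (\<forall>\<theta>. is_mle n G L y \<theta> \<longrightarrow>
             (\<forall>k l. k < l \<and> l < n \<longrightarrow>
                \<bar>(\<theta> $ k - \<theta> $ l) - (\<theta>s $ k - \<theta>s $ l)\<bar>
                  \<le> (if (k, l) \<in> parcs G then B k l else B k l / 2 + Q k l / 8)))}
      \<ge> 1 - \<delta>"
\<comment> \<open>The constant 4 is twice the factor 2 in \<open>noise_deviation\<close>, since only
  half of \<open>B\<close> is available for the noise.\<close>
proof (intro exI[of _ "4 :: real"] conjI allI impI)
  fix n G L \<theta>s \<kappa> and \<delta> :: real and B Q :: "nat \<Rightarrow> nat \<Rightarrow> real"
  assume "btl_model n G L \<theta>s \<kappa>" and \<delta>: "0 < \<delta>" "\<delta> < 1 / 2"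
    and BQ: "\<forall>k<n. \<forall>l<n. k \<noteq> l \<longrightarrow>
       B k l \<ge> 4 * sqrt (eff_resistance n (laplacian n G L \<theta>s) k l * \<kappa> * ln (real n / \<delta>)) \<and>
       Q k l \<ge> (\<Sum>(i, j)\<in>ordered_edges G.
         real (L i j) * (B i j)\<^sup>2 * \<bar>pinv_form n (laplacian n G L \<theta>s) (k, l) (i, j)\<bar>)"
    and QB: "\<forall>(k, l)\<in>parcs G. Q k l \<le> 4 * B k l"
  interpret btl_model n G L \<theta>s \<kappa> by fact
  have B: "4 * sqrt (eff_resistance n Lz k l * \<kappa> * ln (real n / \<delta>)) \<le> B k l"
    and Q: "(\<Sum>e\<in>ordered_edges G. real (L (fst e) (snd e)) * (B (fst e) (snd e))\<^sup>2 *
      \<bar>pinv_form n Lz (k, l) e\<bar>) \<le> Q k l" if "k < l" "l < n" for k l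
    using BQ that by (auto simp: case_prod_beta)
  have QB': "Q k l \<le> 4 * B k l" if "(k, l) \<in> ordered_edges G" for k l
    using QB ordered_edges_subset that by auto
  let ?good = "{y. \<forall>k l. k < l \<and> l < n \<longrightarrow>
      \<bar>\<Sum>e\<in>ordered_edges G. noise y e * pinv_form n Lz (k, l) e\<bar> \<le> B k l / 2}"
  have "1 - \<delta> \<le> measure_pmf.prob (btl_samples G L \<theta>s) ?good"
    by (rule noise_uniform_deviation[OF \<delta> B])
  also have "\<dots> \<le> measure_pmf.prob (btl_samples G L \<theta>s)
      {y. (\<exists>!\<theta>. is_mle n G L y \<theta>) \<and>
          (\<forall>\<theta>. is_mle n G L y \<theta> \<longrightarrow>
             (\<forall>k l. k < l \<and> l < n \<longrightarrow>
                \<bar>(\<theta> $ k - \<theta> $ l) - (\<theta>s $ k - \<theta>s $ l)\<bar>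
                  \<le> (if (k, l) \<in> parcs G then B k l else B k l / 2 + Q k l / 8)))}"
  proof (intro measure_pmf.finite_measure_mono subsetI CollectI conjI allI impI)
    fix y assume "y \<in> ?good"
    then have noise: "\<And>k l. k < l \<Longrightarrow> l < n \<Longrightarrow>
      \<bar>\<Sum>e\<in>ordered_edges G. noise y e * pinv_form n Lz (k, l) e\<bar> \<le> B k l / 2" by blast
    show "\<exists>!\<theta>. is_mle n G L y \<theta>"
      by (rule mle_localization(1)[OF noise Q QB'])
    fix \<theta> k l assume \<theta>: "is_mle n G L y \<theta>" and kl: "k < l \<and> l < n"
    have *: "\<bar>(\<theta> $ k - \<theta> $ l) - (\<theta>s $ k - \<theta>s $ l)\<bar> \<le> B k l / 2 + Q k l / 8"
      using mle_localization(2)[OF noise Q QB' \<theta>] kl by blast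
    show "\<bar>(\<theta> $ k - \<theta> $ l) - (\<theta>s $ k - \<theta>s $ l)\<bar>
        \<le> (if (k, l) \<in> parcs G then B k l else B k l / 2 + Q k l / 8)"
    \<comment> \<open>On an edge, Q \<le> 4B turns B/2 + Q/8 into at most B.\<close>
    proof (cases "(k, l) \<in> parcs G")
      case True
      then have "Q k l \<le> 4 * B k l" using QB by auto
      with * True show ?thesis by simp
    qed (use * in simp)
  qed simp
  finally show "1 - \<delta> \<le> measure_pmf.prob (btl_samples G L \<theta>s)
      {y. (\<exists>!\<theta>. is_mle n G L y \<theta>) \<and>
          (\<forall>\<theta>. is_mle n G L y \<theta> \<longrightarrow>
             (\<forall>k l. k < l \<and> l < n \<longrightarrow>
                \<bar>(\<theta> $ k - \<theta> $ l) - (\<theta>s $ k - \<theta>s $ l)\<bar>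
                  \<le> (if (k, l) \<in> parcs G then B k l else B k l / 2 + Q k l / 8)))}" .
qed simp

end
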